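(* Let $H$ be a formal Hamiltonian as in the context, with alphabet $\Omega=\Omega(H)$, let $X_{\mathrm{sam}}$ be the simplified vector field of $X_H$, let $H^{(1)}$ be the formal Hamiltonian of $X_{\mathrm{sam}}$, and let $\mathfrak{D}^{(1)}_{\tilde\omega}=X_{H^{(1)}_{\tilde\omega}}$ be the vector field induced by the homogeneous component of degree $\tilde\omega$ of $H^{(1)}$, so that $X_{\mathrm{sam}}=X_{\mathrm{lin}}+\sum_{\tilde\omega\in\tilde\Omega}\mathfrak{D}^{(1)}_{\tilde\omega}$, where $\tilde\Omega=\{\|\boldsymbol{\omega}\| : \boldsymbol{\omega}\in\Omega^*\setminus\{\emptyset\}\}$ is the new alphabet. Then the new alphabet is $\tilde\Omega=\Omega$; moreover, for any $\tilde\omega\in\Omega$, $\mathfrak{D}^{(1)}_{\tilde\omega}$ is Hamiltonian and has the expression $$\mathfrak{D}^{(1)}_{\tilde\omega}=\sum_{\substack{\boldsymbol{\omega}\in\Omega^*\\ \|\boldsymbol{\omega}\|=\tilde\omega}}\mathrm{Sam}^{\boldsymbol{\omega}}\,\mathfrak{D}_{\boldsymbol{\omega}} .$$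
   Context: Formal Hamiltonians. Let $\nu\ge 1$, $\lambda=(\lambda_1,\dots,\lambda_\nu)\in\mathbb{C}^\nu$, and consider a formal power series in $(x,y)=(x_1,\dots,x_\nu,y_1,\dots,y_\nu)$ $$H(x,y)=\sum_{i=1}^\nu\lambda_i x_iy_i+\sum_{(n,m)\in A(H)}a_{nm}x^ny^m,\qquad a_{nm}\in\mathbb{C},$$ where $A(H)\subset\mathbb{N}^\nu\times\mathbb{N}^\nu$ is the set of exponents of the higher degree terms ($|n|+|m|\ge 3$). The Hamiltonian vector field of a formal series $G$ is the derivation $X_G=\sum_{i=1}^\nu\left(\frac{\partial G}{\partial x_i}\partial_{y_i}-\frac{\partial G}{\partial y_i}\partial_{x_i}\right)$ of $\mathbb{C}[[x,y]]$; a vector field is Hamiltonian if it is of this form. Put $X_{\mathrm{lin}}=-\sum_i\lambda_ix_i\partial_{x_i}+\sum_i\lambda_iy_i\partial_{y_i}$. Alphabet. For $(n,m)\in\mathbb{N}^\nu\times\mathbb{N}^\nu$ let $\omega(n,m)=\sum_{j=1}^\nu\lambda_j(m_j-n_j)$, and $\Omega=\Omega(H)=\{\omega(n,m):(n,m)\in A(H)\}\subset\mathbb{C}$. For $\omega\in\mathbb{C}$ the homogeneous component of degree $\omega$ of $H$ is $H_\omega=\sum_{(n,m)\in A(H),\ \omega(n,m)=\omega}a_{nm}x^ny^m$, and $\mathfrak{D}_\omega=X_{H_\omega}$. Thus $X_H=X_{\mathrm{lin}}+\sum_{\omega\in\Omega}\mathfrak{D}_\omega$. Words and moulds. $\Omega^*$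 is the set of finite words on $\Omega$, including the empty word $\emptyset$. For $\boldsymbol{\omega}=\omega_1\cdots\omega_r$, $\|\boldsymbol{\omega}\|=\omega_1+\dots+\omega_r$ and $\mathfrak{D}_{\boldsymbol\omega}=\mathfrak{D}_{\omega_1}\circ\cdots\circ\mathfrak{D}_{\omega_r}$ (composition of operators on $\mathbb{C}[[x,y]]$). A mould is a map $M^\bullet:\Omega^*\to\mathbb{C}$, $\boldsymbol\omega\mapsto M^{\boldsymbol\omega}$. The product is $(M^\bullet\times N^\bullet)^{\boldsymbol\omega}=\sum_{\boldsymbol\omega^1\boldsymbol\omega^2=\boldsymbol\omega}M^{\boldsymbol\omega^1}N^{\boldsymbol\omega^2}$ (sum over all factorizations into two possibly empty words), $\mathrm{Exp}\,M^\bullet=\sum_{k\ge0}\frac1{k!}(M^\bullet)^{\times k}$ with $(M^\bullet)^{\times 0}$ the unit for the product, and $(\nabla M^\bullet)^{\boldsymbol\omega}=\|\boldsymbol\omega\|M^{\boldsymbol\omega}$ (with $\|\emptyset\|=0$). $I^\bullet$ is the mould equal to $1$ on words of length $1$ and $0$ otherwise. $V^\bullet$ is the mould with $V^{\boldsymbol\omega}=1/\omega$ if $\boldsymbol\omega=\omega$ has length $1$ and $\omega\ne0$, and $V^{\boldsymbol\omega}=0$ otherwise. The mould $\mathrm{Sam}^\bullet$ is $$\mathrm{Sam}^\bullet=\mathrm{Exp}\,V^\bullet\times I^\bullet\times\mathrm{Exp}(-V^\bullet)-\nabla(\mathrm{Exp}\,V^\bullet)\times\mathrm{Exp}(-V^\bullet).$$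 Simplified field. $$X_{\mathrm{sam}}=\exp\Big(\sum_{\omega\in\Omega,\ \omega\ne0}\tfrac1\omega\mathfrak{D}_\omega\Big)\,X_H\,\exp\Big(-\sum_{\omega\in\Omega,\ \omega\ne0}\tfrac1\omega\mathfrak{D}_\omega\Big)=X_{\mathrm{lin}}+\sum_{\boldsymbol\omega\in\Omega^*}\mathrm{Sam}^{\boldsymbol\omega}\mathfrak{D}_{\boldsymbol\omega}$$ (composition of operators on $\mathbb{C}[[x,y]]$). It is the Hamiltonian vector field of a formal series $H^{(1)}=\sum_i\lambda_ix_iy_i+(\text{terms of total degree}\ge3)$; $H^{(1)}_{\tilde\omega}$ denotes the homogeneous component of degree $\tilde\omega$ of $H^{(1)}$, defined as for $H$.
   Formalization: A(H) is taken to be all exponents with |n|+|m| ≥ 3, zero coefficients allowed, so Ω depends only on λ; with A(H) the support of H, the claim that the new alphabet equals Ω fails, e.g. for H = λxy + x³ with λ ≠ 0. *)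

theory Defs
  imports "HOL-Analysis.Analysis"
begin

text \<open>
  The finite type \<open>'n\<close> indexes the degrees of freedom, so \<open>\<nu> = CARD('n)\<close>.
  A series in \<open>x_1, ..., x_\<nu>, y_1, ..., y_\<nu>\<close> is given by its coefficients; the exponent
  \<open>(n, m)\<close> stands for the monomial \<open>x^n y^m\<close>.
\<close>

type_synonym 'n expo = "(nat ^ 'n) \<times> (nat ^ 'n)"

definition expo_deg :: "'n::finite expo \<Rightarrow> nat" where
  "expo_deg k = (\<Sum>i\<in>UNIV. fst k $ i) + (\<Sum>i\<in>UNIV. snd k $ i)"

typedef 'n fseries = "UNIV :: ('n::finite expo \<Rightarrow> complex) set"
  morphisms fcoeff Abs_fseries
  by simp

lemma fcoeff_Abs_fseries [simp]: "fcoeff (Abs_fseries g) = g"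
  by (simp add: Abs_fseries_inverse)

lemma fseries_eqI: "(\<And>k. fcoeff f k = fcoeff g k) \<Longrightarrow> f = g"
  by (metis ext fcoeff_inject)

lemma finite_expo_le: "finite {a :: nat ^ 'n::finite. \<exists>b. a + b = k}"
proof -
  have "finite (vec_nth ` {a :: nat ^ 'n. \<exists>b. a + b = k})"
  proof (rule finite_subset)
    show "vec_nth ` {a :: nat ^ 'n. \<exists>b. a + b = k} \<subseteq> (\<Pi>\<^sub>E i\<in>UNIV. {..k $ i})"
      by (auto simp: PiE_iff)
    show "finite (\<Pi>\<^sub>E i\<in>UNIV. {..(k::nat ^ 'n) $ i})"
      by (intro finite_PiE) auto
  qed
  then show ?thesis
    by (rule finite_imageD) (auto simp: inj_on_def vec_nth_inject)
qed

lemma finite_expo_splits: "finite {p :: 'n::finite expo \<times> 'n expo. fst p + snd p = k}"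
proof -
  let ?L = "\<lambda>k. {a :: nat ^ 'n. \<exists>b. a + b = k}"
  have "{p :: 'n expo \<times> 'n expo. fst p + snd p = k}
        \<subseteq> (?L (fst k) \<times> ?L (snd k)) \<times> (?L (fst k) \<times> ?L (snd k))"
    by (auto simp: add.commute) (metis add.commute)+
  then show ?thesis
    by (rule finite_subset) (intro finite_cartesian_product finite_expo_le)
qed

instantiation fseries :: (finite) comm_ring_1
begin

definition zero_fseries :: "'a fseries" where
  "0 = Abs_fseries (\<lambda>_. 0)"

definition one_fseries :: "'a fseries" where
  "1 = Abs_fseries (\<lambda>k. if k = 0 then 1 else 0)"

definition plus_fseries :: "'a fseries \<Rightarrow> 'a fseries \<Rightarrow> 'a fseries" where
  "f + g = Abs_fseries (\<lambda>k. fcoeff f k + fcoeff g k)"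

definition uminus_fseries :: "'a fseries \<Rightarrow> 'a fseries" where
  "- f = Abs_fseries (\<lambda>k. - fcoeff f k)"

definition minus_fseries :: "'a fseries \<Rightarrow> 'a fseries \<Rightarrow> 'a fseries" where
  "f - g = Abs_fseries (\<lambda>k. fcoeff f k - fcoeff g k)"

definition times_fseries :: "'a fseries \<Rightarrow> 'a fseries \<Rightarrow> 'a fseries" where
  "f * g = Abs_fseries (\<lambda>k. \<Sum>p | fst p + snd p = k. fcoeff f (fst p) * fcoeff g (snd p))"

instance
proof
  fix a b c :: "'a fseries"
  show "a * b * c = a * (b * c)"
  proof (rule fseries_eqI)
    fix k
    let ?S = "\<lambda>k. {p :: 'a expo \<times> 'a expo. fst p + snd p = k}"
    have "fcoeff (a * b * c) k =
       (\<Sum>(p, q) \<in> (SIGMA p:?S k. ?S (fst p)).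
          fcoeff a (fst q) * fcoeff b (snd q) * fcoeff c (snd p))"
      by (simp add: times_fseries_def sum_distrib_right sum.Sigma finite_expo_splits)
    also have "\<dots> = (\<Sum>(p, q) \<in> (SIGMA p:?S k. ?S (snd p)).
          fcoeff a (fst p) * (fcoeff b (fst q) * fcoeff c (snd q)))"
      by (rule sum.reindex_bij_witness
          [where j = "\<lambda>(p, q). ((fst q, snd q + snd p), (snd q, snd p))"
             and i = "\<lambda>(p, q). ((fst p + fst q, snd q), (fst p, fst q))"])
         (auto simp: add.assoc mult.assoc)
    also have "\<dots> = fcoeff (a * (b * c)) k"
      by (simp add: times_fseries_def sum_distrib_left sum.Sigma finite_expo_splits)
    finally show "fcoeff (a * b * c) k = fcoeff (a * (b * c)) k" .
  qed
  show "a * b = b * a"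
  proof (rule fseries_eqI)
    fix k
    show "fcoeff (a * b) k = fcoeff (b * a) k"
      unfolding times_fseries_def fcoeff_Abs_fseries
      by (rule sum.reindex_bij_witness[where i = prod.swap and j = prod.swap])
         (auto simp: add.commute mult.commute)
  qed
  show "1 * a = a"
  proof (rule fseries_eqI)
    fix k
    have "fcoeff (1 * a) k = (\<Sum>p | fst p + snd p = k. if p = (0, k) then fcoeff a k else 0)"
      unfolding times_fseries_def one_fseries_def fcoeff_Abs_fseries
      by (rule sum.cong) auto
    then show "fcoeff (1 * a) k = fcoeff a k"
      using finite_expo_splits[of k] by simp
  qed
  show "(a + b) * c = a * c + b * c"
    by (rule fseries_eqI)
       (simp add: times_fseries_def plus_fseries_def distrib_right sum.distrib)
  show "(0 :: 'a fseries) \<noteq> 1"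
    by (metis (mono_tags) fcoeff_Abs_fseries one_fseries_def zero_fseries_def zero_neq_one)
qed (auto intro!: fseries_eqI
      simp: plus_fseries_def zero_fseries_def minus_fseries_def uminus_fseries_def)

end

definition fscale :: "complex \<Rightarrow> 'n::finite fseries \<Rightarrow> 'n fseries" where
  "fscale c f = Abs_fseries (\<lambda>k. c * fcoeff f k)"

definition var_x :: "'n::finite \<Rightarrow> 'n fseries" where
  "var_x i = Abs_fseries (\<lambda>k. if k = (axis i 1, 0) then 1 else 0)"

definition var_y :: "'n::finite \<Rightarrow> 'n fseries" where
  "var_y i = Abs_fseries (\<lambda>k. if k = (0, axis i 1) then 1 else 0)"

definition deriv_x :: "'n::finite \<Rightarrow> 'n fseries \<Rightarrow> 'n fseries" where
  "deriv_x i f =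
     Abs_fseries (\<lambda>(n, m). of_nat (n $ i + 1) * fcoeff f (n + axis i 1, m))"

definition deriv_y :: "'n::finite \<Rightarrow> 'n fseries \<Rightarrow> 'n fseries" where
  "deriv_y i f =
     Abs_fseries (\<lambda>(n, m). of_nat (m $ i + 1) * fcoeff f (n, m + axis i 1))"

text \<open>
  Infinite sums of formal series: a family is summable if every coefficient vanishes for all but
  finitely many members, and its sum is then taken coefficientwise.  The total function
  \<open>fsum\<close> is meaningful only for summable families; all families below to which it is
  applied are summable when the Hamiltonian has the form \<open>formal_hamiltonian\<close>.
\<close>

definition has_fsum :: "('i \<Rightarrow> 'n::finite fseries) \<Rightarrow> 'i set \<Rightarrow> 'n fseries \<Rightarrow> bool" where
  "has_fsum F I S \<longleftrightarrow>
     (\<forall>k. finite {i \<in> I. fcoeff (F i) k \<noteq> 0} \<and>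
          fcoeff S k = (\<Sum>i | i \<in> I \<and> fcoeff (F i) k \<noteq> 0. fcoeff (F i) k))"

definition fsum :: "('i \<Rightarrow> 'n::finite fseries) \<Rightarrow> 'i set \<Rightarrow> 'n fseries" where
  "fsum F I =
     Abs_fseries (\<lambda>k. \<Sum>i | i \<in> I \<and> fcoeff (F i) k \<noteq> 0. fcoeff (F i) k)"

definition op_exp :: "('n::finite fseries \<Rightarrow> 'n fseries) \<Rightarrow> 'n fseries \<Rightarrow> 'n fseries" where
  "op_exp T f = fsum (\<lambda>j. fscale (1 / fact j) ((T ^^ j) f)) UNIV"

definition ham_field :: "'n::finite fseries \<Rightarrow> 'n fseries \<Rightarrow> 'n fseries" where
  "ham_field G f = (\<Sum>i\<in>UNIV. deriv_x i G * deriv_y i f - deriv_y i G * deriv_x i f)"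

definition is_hamiltonian :: "('n::finite fseries \<Rightarrow> 'n fseries) \<Rightarrow> bool" where
  "is_hamiltonian X \<longleftrightarrow> (\<exists>G. X = ham_field G)"

definition quad_part :: "complex ^ 'n::finite \<Rightarrow> 'n fseries" where
  "quad_part lam = (\<Sum>i\<in>UNIV. fscale (lam $ i) (var_x i * var_y i))"

definition lin_field :: "complex ^ 'n::finite \<Rightarrow> 'n fseries \<Rightarrow> 'n fseries" where
  "lin_field lam f =
     (\<Sum>i\<in>UNIV. fscale (lam $ i) (var_y i * deriv_y i f))
     - (\<Sum>i\<in>UNIV. fscale (lam $ i) (var_x i * deriv_x i f))"

text \<open>
  All exponents of degree at least 3 are admitted, with coefficients that may be zero.
  (The support of the Hamiltonian would not do: its weights need not be closed under addition.)
  Hence the alphabet depends on the Hamiltonian only through \<open>lam\<close>; letters whose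
  homogeneous component is zero contribute nothing to any sum below.
\<close>

definition higher_exps :: "'n::finite expo set" where
  "higher_exps = {k. 3 \<le> expo_deg k}"

definition formal_hamiltonian :: "complex ^ 'n::finite \<Rightarrow> 'n fseries \<Rightarrow> bool" where
  "formal_hamiltonian lam H \<longleftrightarrow>
     (\<forall>k. k \<notin> higher_exps \<longrightarrow> fcoeff H k = fcoeff (quad_part lam) k)"

definition weight :: "complex ^ 'n::finite \<Rightarrow> 'n expo \<Rightarrow> complex" where
  "weight lam k = (\<Sum>j\<in>UNIV. lam $ j * (of_nat (snd k $ j) - of_nat (fst k $ j)))"

definition alphabet :: "complex ^ 'n::finite \<Rightarrow> complex set" where
  "alphabet lam = weight lam ` higher_exps"

definition hom_comp :: "complex ^ 'n::finite \<Rightarrow> 'n fseries \<Rightarrow> complex \<Rightarrow> 'n fseries" where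
  "hom_comp lam H w =
     Abs_fseries (\<lambda>k. if k \<in> higher_exps \<and> weight lam k = w then fcoeff H k else 0)"

definition letter_field ::
  "complex ^ 'n::finite \<Rightarrow> 'n fseries \<Rightarrow> complex \<Rightarrow> 'n fseries \<Rightarrow> 'n fseries" where
  "letter_field lam H w = ham_field (hom_comp lam H w)"

definition word_field ::
  "complex ^ 'n::finite \<Rightarrow> 'n fseries \<Rightarrow> complex list \<Rightarrow> 'n fseries \<Rightarrow> 'n fseries" where
  "word_field lam H ws = foldr (\<lambda>w T. letter_field lam H w \<circ> T) ws id"

definition new_alphabet :: "complex ^ 'n::finite \<Rightarrow> complex set" where
  "new_alphabet lam = {sum_list ws | ws. ws \<in> lists (alphabet lam) \<and> ws \<noteq> []}"

text \<open>
  Moulds are given on all complex words; this agrees with moulds on the words over an alphabet,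
  because every operation on moulds evaluates its arguments only at factors of the given word.
\<close>

type_synonym mould = "complex list \<Rightarrow> complex"

definition mould_mult :: "mould \<Rightarrow> mould \<Rightarrow> mould" where
  "mould_mult M N ws = (\<Sum>p | fst p @ snd p = ws. M (fst p) * N (snd p))"

definition mould_one :: mould where
  "mould_one ws = (if ws = [] then 1 else 0)"

definition mould_exp :: "mould \<Rightarrow> mould" where
  "mould_exp M ws = (\<Sum>k. (1 / fact k) * ((mould_mult M ^^ k) mould_one) ws)"

definition mould_nabla :: "mould \<Rightarrow> mould" where
  "mould_nabla M ws = sum_list ws * M ws"

definition mould_I :: mould where
  "mould_I ws = (if length ws = 1 then 1 else 0)"

definition mould_V :: mould where
  "mould_V ws = (if length ws = 1 \<and> hd ws \<noteq> 0 then 1 / hd ws else 0)"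

definition mould_Sam :: mould where
  "mould_Sam ws =
     mould_mult (mould_mult (mould_exp mould_V) mould_I) (mould_exp (\<lambda>u. - mould_V u)) ws
     - mould_mult (mould_nabla (mould_exp mould_V)) (mould_exp (\<lambda>u. - mould_V u)) ws"

definition sam_generator ::
  "complex ^ 'n::finite \<Rightarrow> 'n fseries \<Rightarrow> 'n fseries \<Rightarrow> 'n fseries" where
  "sam_generator lam H f =
     fsum (\<lambda>w. fscale (1 / w) (letter_field lam H w f)) (alphabet lam - {0})"

definition sam_field ::
  "complex ^ 'n::finite \<Rightarrow> 'n fseries \<Rightarrow> 'n fseries \<Rightarrow> 'n fseries" where
  "sam_field lam H =
     op_exp (sam_generator lam H) \<circ> ham_field H \<circ> op_exp (\<lambda>f. - sam_generator lam H f)"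

definition sam_hamiltonian :: "complex ^ 'n::finite \<Rightarrow> 'n fseries \<Rightarrow> 'n fseries \<Rightarrow> bool" where
  "sam_hamiltonian lam H H1 \<longleftrightarrow>
     formal_hamiltonian lam H1 \<and> sam_field lam H = ham_field H1"

end

(*
  A mould M acts on series as the operator sum of M^ws D_ws over all words; products of moulds
  become compositions, I becomes X_H - X_lin, V becomes the generator T, Exp V becomes exp T, and
  nabla becomes the commutator with X_lin because D_ws shifts weights by the sum of ws.  This gives
  X_sam - X_lin = sum of Sam^ws D_ws.  As exp T is an automorphism of the Poisson bracket with
  inverse exp(-T), X_sam is the Hamiltonian field of exp(T) H.  Comparing the parts of equal weight
  yields the formula for each component.  All sums are locally finite: every letter raises the
  degree, and a fixed coefficient of D_w f sees only finitely many w.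
*)

theory Submission
  imports Defs
begin

text \<open>The alphabet may be infinite and need not be discrete in the complex plane, so
  finiteness cannot come from the letters themselves. It comes from exponents: a letter that carries
  exponent \<open>q\<close> to exponent \<open>k\<close> must equal the weight of \<open>k\<close>
  minus that of \<open>q\<close>, and \<open>q\<close> ranges over a finite set depending on
  \<open>k\<close> alone. Every interchange of sums is thus finite at each coefficient, provided the
  operators involved read only finitely many input coefficients per output coefficient. The
  generator T is itself a Hamiltonian field, so the Jacobi identity makes it a derivation of the
  bracket. That exp(-T) inverts exp T is visible on moulds, where a word of length r produces the
  binomial expansion of (1 - 1)^r. A field determines its Hamiltonian only up to a constant; the
  prescribed terms of degree below 3 remove this freedom. The final comparison of weights acts on
  the argument: for output exponent \<open>k\<close> and weight \<open>w\<close>, the series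
  \<open>f\<close> is replaced by its part of weight \<open>weight lam k - w\<close>.\<close>

section \<open>Coefficient rules for the ring operations, scaling and partial derivatives\<close>

lemma fcoeff_zero [simp]: "fcoeff 0 k = 0"
  and fcoeff_add [simp]: "fcoeff (f + g) k = fcoeff f k + fcoeff g k"
  and fcoeff_diff [simp]: "fcoeff (f - g) k = fcoeff f k - fcoeff g k"
  and fcoeff_uminus [simp]: "fcoeff (- f) k = - fcoeff f k"
  and fcoeff_fscale [simp]: "fcoeff (fscale c f) k = c * fcoeff f k"
  by (simp_all add: zero_fseries_def plus_fseries_def minus_fseries_def uminus_fseries_def
      fscale_def)

lemma fcoeff_sum [simp]: "fcoeff (sum F A) k = (\<Sum>i\<in>A. fcoeff (F i) k)"
  by (induction A rule: infinite_finite_induct) auto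

lemma fcoeff_times: "fcoeff (f * g) k = (\<Sum>p | fst p + snd p = k. fcoeff f (fst p) * fcoeff g (snd p))"
  by (simp add: times_fseries_def)

lemma fcoeff_deriv_x: "fcoeff (deriv_x i f) k = of_nat (fst k $ i + 1) * fcoeff f (k + (axis i 1, 0))"
  by (cases k) (simp add: deriv_x_def)

lemma fcoeff_deriv_y: "fcoeff (deriv_y i f) k = of_nat (snd k $ i + 1) * fcoeff f (k + (0, axis i 1))"
  by (cases k) (simp add: deriv_y_def)

lemma fscale_times [simp]: "fscale c f * g = fscale c (f * g)" "f * fscale c g = fscale c (f * g)"
  by (rule fseries_eqI; simp add: fcoeff_times sum_distrib_left mult.assoc mult.left_commute)+

lemma fscale_one [simp]: "fscale 1 f = f"
  by (rule fseries_eqI) simp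

lemma fscale_fscale [simp]: "fscale a (fscale b f) = fscale (a * b) f"
  by (rule fseries_eqI) simp

lemma fscale_zero [simp]: "fscale 0 f = 0" "fscale c 0 = 0"
  by (rule fseries_eqI; simp)+

lemma fscale_add: "fscale c (f + g) = fscale c f + fscale c g"
  and fscale_diff: "fscale c (f - g) = fscale c f - fscale c g"
  by (rule fseries_eqI; simp add: algebra_simps)+

lemma fscale_sum: "fscale c (sum F A) = (\<Sum>i\<in>A. fscale c (F i))"
  by (rule fseries_eqI) (simp add: sum_distrib_left)

text \<open>Exponents are pairs but are mostly handled as single monoid elements; the simplifier
  should not split quantifiers over them.\<close>

declare split_paired_All [simp del] split_paired_Ex [simp del]

section \<open>Formal sums\<close>

text \<open>Any finite set containing the support will do, so later proofs can use a convenient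
  bound such as a degree estimate instead of the exact support.\<close>

lemma has_fsumI:
  assumes "\<And>k. \<exists>J. finite J \<and> J \<subseteq> I \<and> (\<forall>i\<in>I - J. fcoeff (F i) k = 0) \<and>
                   fcoeff S k = (\<Sum>i\<in>J. fcoeff (F i) k)"
  shows "has_fsum F I S"
  unfolding has_fsum_def
proof
  fix k
  obtain J where J: "finite J" "J \<subseteq> I" "\<forall>i\<in>I - J. fcoeff (F i) k = 0"
    and S: "fcoeff S k = (\<Sum>i\<in>J. fcoeff (F i) k)"
    using assms by blast
  have sub: "{i \<in> I. fcoeff (F i) k \<noteq> 0} \<subseteq> J"
    using J by auto
  have "(\<Sum>i\<in>J. fcoeff (F i) k) = (\<Sum>i | i \<in> I \<and> fcoeff (F i) k \<noteq> 0. fcoeff (F i) k)"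
    using J sub by (intro sum.mono_neutral_right) auto
  then show "finite {i \<in> I. fcoeff (F i) k \<noteq> 0} \<and>
      fcoeff S k = (\<Sum>i | i \<in> I \<and> fcoeff (F i) k \<noteq> 0. fcoeff (F i) k)"
    using S finite_subset[OF sub J(1)] by simp
qed

lemma has_fsum_coeff:
  assumes "has_fsum F I S" "finite J" "J \<subseteq> I" "\<forall>i\<in>I - J. fcoeff (F i) k = 0"
  shows "fcoeff S k = (\<Sum>i\<in>J. fcoeff (F i) k)"
proof -
  have "fcoeff S k = (\<Sum>i | i \<in> I \<and> fcoeff (F i) k \<noteq> 0. fcoeff (F i) k)"
    using assms(1) by (simp add: has_fsum_def)
  also have "\<dots> = (\<Sum>i\<in>J. fcoeff (F i) k)"
    using assms by (intro sum.mono_neutral_left) auto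
  finally show ?thesis .
qed

lemma has_fsum_support:
  "has_fsum F I S \<Longrightarrow> \<exists>J. finite J \<and> J \<subseteq> I \<and> (\<forall>i\<in>I - J. fcoeff (F i) k = 0)"
  by (rule exI[of _ "{i \<in> I. fcoeff (F i) k \<noteq> 0}"]) (auto simp: has_fsum_def)

lemma has_fsum_fsum: "(\<And>k. finite {i \<in> I. fcoeff (F i) k \<noteq> 0}) \<Longrightarrow> has_fsum F I (fsum F I)"
  by (simp add: has_fsum_def fsum_def)

lemma fsum_eqI: "has_fsum F I S \<Longrightarrow> fsum F I = S"
  by (rule fseries_eqI) (simp add: has_fsum_def fsum_def)

lemma has_fsum_unique: "has_fsum F I S \<Longrightarrow> has_fsum F I S' \<Longrightarrow> S = S'"
  using fsum_eqI[of F I S] fsum_eqI[of F I S'] by simp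

lemma has_fsum_cong:
  "(\<And>i. i \<in> I \<Longrightarrow> F i = G i) \<Longrightarrow> has_fsum F I S \<longleftrightarrow> has_fsum G I S"
  by (simp add: has_fsum_def cong: conj_cong)

lemma has_fsum_mono_neutral:
  assumes "I \<subseteq> J" "\<And>i. i \<in> J - I \<Longrightarrow> F i = 0"
  shows "has_fsum F J S \<longleftrightarrow> has_fsum F I S"
proof -
  have "{i \<in> J. fcoeff (F i) k \<noteq> 0} = {i \<in> I. fcoeff (F i) k \<noteq> 0}" for k
    using assms by force
  then show ?thesis
    by (simp add: has_fsum_def)
qed

lemma has_fsum_add:
  assumes F: "has_fsum F I S" and G: "has_fsum G I T"
  shows "has_fsum (\<lambda>i. F i + G i) I (S + T)"
proof (rule has_fsumI)
  fix k
  obtain J where J: "finite J" "J \<subseteq> I" "\<forall>i\<in>I - J. fcoeff (F i) k = 0"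
    using has_fsum_support[OF F, of k] by blast
  obtain K where K: "finite K" "K \<subseteq> I" "\<forall>i\<in>I - K. fcoeff (G i) k = 0"
    using has_fsum_support[OF G, of k] by blast
  have "fcoeff S k = (\<Sum>i\<in>J \<union> K. fcoeff (F i) k)" "fcoeff T k = (\<Sum>i\<in>J \<union> K. fcoeff (G i) k)"
    using J K by (auto intro!: has_fsum_coeff[OF F] has_fsum_coeff[OF G])
  then show "\<exists>L. finite L \<and> L \<subseteq> I \<and> (\<forall>i\<in>I - L. fcoeff (F i + G i) k = 0) \<and>
      fcoeff (S + T) k = (\<Sum>i\<in>L. fcoeff (F i + G i) k)"
    using J K by (intro exI[of _ "J \<union> K"]) (auto simp: sum.distrib)
qed

text \<open>Fubini for formal sums. Summability is required of the double family, because
  cancellation inside rows could hide infinitely many nonzero entries. At a given coefficient, rows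
  outside the projection of the finite support contribute zero.\<close>

lemma has_fsum_Sigma:
  assumes F: "has_fsum (\<lambda>(i, j). F i j) (Sigma I B) S"
    and G: "\<And>i. i \<in> I \<Longrightarrow> has_fsum (F i) (B i) (G i)"
  shows "has_fsum G I S"
proof (rule has_fsumI)
  fix k
  let ?P = "{x \<in> Sigma I B. fcoeff (F (fst x) (snd x)) k \<noteq> 0}"
  let ?R = "\<lambda>i. {j \<in> B i. fcoeff (F i j) k \<noteq> 0}"
  have fin: "finite ?P" and S: "fcoeff S k = (\<Sum>x\<in>?P. fcoeff (F (fst x) (snd x)) k)"
    using F by (simp_all add: has_fsum_def case_prod_beta)
  have Gi: "finite (?R i)" "fcoeff (G i) k = (\<Sum>j\<in>?R i. fcoeff (F i j) k)" if "i \<in> I" for i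
    using G[OF that] by (simp_all add: has_fsum_def)
  have P: "?P = Sigma (fst ` ?P) ?R"
    by force
  have sub: "fst ` ?P \<subseteq> I"
    by auto
  have "(\<Sum>x\<in>?P. fcoeff (F (fst x) (snd x)) k) = (\<Sum>i\<in>fst ` ?P. \<Sum>j\<in>?R i. fcoeff (F i j) k)"
    using Gi(1) sub fin by (subst P, subst sum.Sigma) (auto simp: case_prod_beta)
  also have "\<dots> = (\<Sum>i\<in>fst ` ?P. fcoeff (G i) k)"
    using Gi(2) sub by (intro sum.cong) auto
  finally have "fcoeff S k = (\<Sum>i\<in>fst ` ?P. fcoeff (G i) k)"
    using S by simp
  moreover have "fcoeff (G i) k = 0" if "i \<in> I - fst ` ?P" for i
  proof -
    have "?R i = {}"
      using that by force
    then show ?thesis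
      using Gi(2)[of i] that by simp
  qed
  ultimately show "\<exists>J. finite J \<and> J \<subseteq> I \<and> (\<forall>i\<in>I - J. fcoeff (G i) k = 0) \<and>
      fcoeff S k = (\<Sum>i\<in>J. fcoeff (G i) k)"
    using fin sub by (intro exI[of _ "fst ` ?P"]) auto
qed

lemma has_fsum_reindex:
  assumes h: "bij_betw h A B" and F: "has_fsum F B S"
  shows "has_fsum (\<lambda>a. F (h a)) A S"
proof (rule has_fsumI)
  fix k
  obtain J where J: "finite J" "J \<subseteq> B" "\<forall>i\<in>B - J. fcoeff (F i) k = 0"
    using has_fsum_support[OF F, of k] by blast
  let ?L = "{a \<in> A. h a \<in> J}"
  have img: "h ` ?L = J" and inj: "inj_on h ?L"
    using h J(2) by (auto simp: bij_betw_def inj_on_def)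
  have "finite ?L"
    using J(1) img inj finite_image_iff by metis
  moreover have "fcoeff S k = (\<Sum>a\<in>?L. fcoeff (F (h a)) k)"
    using has_fsum_coeff[OF F J] sum.reindex[OF inj, of "\<lambda>i. fcoeff (F i) k"] img by simp
  moreover have "fcoeff (F (h a)) k = 0" if "a \<in> A - ?L" for a
    using that J(3) h by (auto simp: bij_betw_def)
  ultimately show "\<exists>L. finite L \<and> L \<subseteq> A \<and> (\<forall>a\<in>A - L. fcoeff (F (h a)) k = 0) \<and>
      fcoeff S k = (\<Sum>a\<in>L. fcoeff (F (h a)) k)"
    by (intro exI[of _ ?L]) auto
qed

lemma has_fsum_group:
  assumes F: "has_fsum F UNIV S" and G: "\<And>j. has_fsum F {i. g i = j} (G j)"
  shows "has_fsum G UNIV S"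
proof (rule has_fsum_Sigma[where F = "\<lambda>_. F" and B = "\<lambda>j. {i. g i = j}"])
  have "bij_betw snd (SIGMA j:UNIV. {i. g i = j}) UNIV"
    by (rule bij_betw_byWitness[where f' = "\<lambda>i. (g i, i)"]) auto
  from has_fsum_reindex[OF this F] show "has_fsum (\<lambda>(j, i). F i) (SIGMA j:UNIV. {i. g i = j}) S"
    unfolding case_prod_beta .
qed (use G in simp)

text \<open>
  The last clause is continuity for the product topology of the coefficients, with the discrete
  topology on the scalars.
\<close>

definition fcont :: "('n::finite fseries \<Rightarrow> 'n fseries) \<Rightarrow> bool" where
  "fcont T \<longleftrightarrow> (\<forall>f g. T (f + g) = T f + T g) \<and> (\<forall>c f. T (fscale c f) = fscale c (T f)) \<and>
     (\<forall>k. \<exists>K. finite K \<and> (\<forall>f. (\<forall>l\<in>K. fcoeff f l = 0) \<longrightarrow> fcoeff (T f) k = 0))"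

lemma fcont_add: "fcont T \<Longrightarrow> T (f + g) = T f + T g"
  and fcont_fscale: "fcont T \<Longrightarrow> T (fscale c f) = fscale c (T f)"
  by (simp_all add: fcont_def)

lemma fcont_zero: "fcont T \<Longrightarrow> T 0 = 0"
  using fcont_fscale[of T 0 0] by simp

lemma fcont_uminus: "fcont T \<Longrightarrow> T (- f) = - T f"
  using fcont_add[of T f "- f"] by (simp add: fcont_zero add_eq_0_iff)

lemma fcont_diff: "fcont T \<Longrightarrow> T (f - g) = T f - T g"
  using fcont_add[of T f "- g"] by (simp add: fcont_uminus)

lemma fcont_sum: "fcont T \<Longrightarrow> T (sum F A) = (\<Sum>i\<in>A. T (F i))"
  by (induction A rule: infinite_finite_induct) (auto simp: fcont_add fcont_zero)

text \<open>Coefficient \<open>k\<close> of the output reads only the coefficients of the input in a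
  finite set \<open>K\<close>, and on \<open>K\<close> the sum \<open>S\<close> agrees with one
  finite partial sum. Additivity on that partial sum then suffices.\<close>

lemma fcont_has_fsum:
  assumes T: "fcont T" and F: "has_fsum F I S"
  shows "has_fsum (\<lambda>i. T (F i)) I (T S)"
proof (rule has_fsumI)
  fix k
  obtain K where K: "finite K" "\<And>f. \<forall>l\<in>K. fcoeff f l = 0 \<Longrightarrow> fcoeff (T f) k = 0"
    using T unfolding fcont_def by meson
  have "\<forall>l. \<exists>J. finite J \<and> J \<subseteq> I \<and> (\<forall>i\<in>I - J. fcoeff (F i) l = 0)"
    using has_fsum_support[OF F] by blast
  then obtain J where J: "\<And>l. finite (J l)" "\<And>l. J l \<subseteq> I" "\<And>l i. i \<in> I - J l \<Longrightarrow> fcoeff (F i) l = 0"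
    unfolding choice_iff by blast
  let ?L = "\<Union>l\<in>K. J l"
  have L: "finite ?L" "?L \<subseteq> I"
    using K(1) J(1,2) by blast+
  have "fcoeff (T (F i)) k = 0" if "i \<in> I - ?L" for i
    using that J(3) by (intro K(2)) auto
  moreover have "fcoeff (T (S - sum F ?L)) k = 0"
  proof (rule K(2), intro ballI)
    fix l assume "l \<in> K"
    then have "fcoeff S l = (\<Sum>i\<in>?L. fcoeff (F i) l)"
      using L J(3) by (intro has_fsum_coeff[OF F]) auto
    then show "fcoeff (S - sum F ?L) l = 0"
      by simp
  qed
  then have "fcoeff (T S) k = (\<Sum>i\<in>?L. fcoeff (T (F i)) k)"
    by (simp add: fcont_diff[OF T] fcont_sum[OF T])
  ultimately show "\<exists>L. finite L \<and> L \<subseteq> I \<and> (\<forall>i\<in>I - L. fcoeff (T (F i)) k = 0) \<and>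
      fcoeff (T S) k = (\<Sum>i\<in>L. fcoeff (T (F i)) k)"
    using L by blast
qed

lemma fcont_fscale_op: "fcont (fscale c)"
  by (auto simp: fcont_def intro!: fseries_eqI exI[of _ "{_}"] simp: algebra_simps)

lemma has_fsum_fscale: "has_fsum F I S \<Longrightarrow> has_fsum (\<lambda>i. fscale c (F i)) I (fscale c S)"
  by (rule fcont_has_fsum[OF fcont_fscale_op])

section \<open>The Poisson bracket\<close>

text \<open>
  Both partial derivatives are instances: \<open>e\<close> is a basis exponent and \<open>c\<close> reads off
  the corresponding component.
\<close>

lemma weighted_shift_mult:
  fixes c :: "'n::finite expo \<Rightarrow> nat" and f g :: "'n fseries"
  assumes add: "\<And>p q. c (p + q) = c p + c q" and e: "c e = 1"
    and ex: "\<And>p. c p \<noteq> 0 \<Longrightarrow> \<exists>p'. p = p' + e"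
    and d: "\<And>h k. fcoeff (d h) k = of_nat (c k + 1) * fcoeff h (k + e)"
  shows "d (f * g) = d f * g + f * d g"
proof -
  let ?S = "\<lambda>k. {p :: 'n expo \<times> 'n expo. fst p + snd p = k}"
  \<comment> \<open>Adding \<open>e\<close> to the first part embeds the splittings of
    \<open>k\<close> into those of \<open>k + e\<close>. The splittings that are missed have a first
    part not containing \<open>e\<close>, where the factor \<open>c\<close> vanishes.\<close>
  have *: "(\<Sum>p\<in>?S (k + e). of_nat (c (fst p)) * fcoeff f (fst p) * fcoeff g (snd p)) =
      fcoeff (d f * g) k" for f g k
  proof -
    have inj: "inj_on (\<lambda>p :: 'n expo \<times> 'n expo. (fst p + e, snd p)) (?S k)"
      by (rule inj_onI) (simp add: prod_eq_iff)
    have "fcoeff (d f * g) k = (\<Sum>p\<in>(\<lambda>p. (fst p + e, snd p)) ` ?S k.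
        of_nat (c (fst p)) * fcoeff f (fst p) * fcoeff g (snd p))"
      unfolding sum.reindex[OF inj] fcoeff_times
      by (rule sum.cong[OF refl]) (simp add: d add e)
    also have "\<dots> = (\<Sum>p\<in>?S (k + e). of_nat (c (fst p)) * fcoeff f (fst p) * fcoeff g (snd p))"
    proof (rule sum.mono_neutral_left)
      show "\<forall>p\<in>?S (k + e) - (\<lambda>p. (fst p + e, snd p)) ` ?S k.
          of_nat (c (fst p)) * fcoeff f (fst p) * fcoeff g (snd p) = 0"
      proof
        fix p assume p: "p \<in> ?S (k + e) - (\<lambda>p. (fst p + e, snd p)) ` ?S k"
        have "c (fst p) = 0"
        proof (rule ccontr)
          assume "c (fst p) \<noteq> 0"
          then obtain p' where p': "fst p = p' + e"
            using ex by blast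
          then have "(p' + snd p) + e = k + e"
            using p by (simp add: ac_simps)
          then have "p = (\<lambda>p. (fst p + e, snd p)) (p', snd p)" "(p', snd p) \<in> ?S k"
            using p' by (auto simp: prod_eq_iff)
          with p show False
            by blast
        qed
        then show "of_nat (c (fst p)) * fcoeff f (fst p) * fcoeff g (snd p) = 0"
          by simp
      qed
    qed (auto simp: finite_expo_splits ac_simps)
    finally show ?thesis ..
  qed
  show ?thesis
  proof (rule fseries_eqI)
    fix k
    have "fcoeff (d (f * g)) k = (\<Sum>p\<in>?S (k + e). of_nat (c k + 1) * (fcoeff f (fst p) * fcoeff g (snd p)))"
      by (simp add: d fcoeff_times sum_distrib_left)
    also have "\<dots> = (\<Sum>p\<in>?S (k + e). of_nat (c (fst p)) * fcoeff f (fst p) * fcoeff g (snd p)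
        + of_nat (c (snd p)) * fcoeff g (snd p) * fcoeff f (fst p))"
    proof (rule sum.cong)
      \<comment> \<open>The Leibniz rule at the level of coefficients: \<open>c\<close> is additive,
        so its value at \<open>k + e\<close> is shared between the two parts of the
        splitting.\<close>
      fix p assume "p \<in> ?S (k + e)"
      then have "c k + 1 = c (fst p) + c (snd p)"
        using add[of k e] add[of "fst p" "snd p"] e by simp
      then show "of_nat (c k + 1) * (fcoeff f (fst p) * fcoeff g (snd p)) =
        of_nat (c (fst p)) * fcoeff f (fst p) * fcoeff g (snd p)
        + of_nat (c (snd p)) * fcoeff g (snd p) * fcoeff f (fst p)"
        by (simp only: of_nat_add) (simp add: algebra_simps)
    qed simp
    also have "(\<Sum>p\<in>?S (k + e). of_nat (c (snd p)) * fcoeff g (snd p) * fcoeff f (fst p)) =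
        (\<Sum>p\<in>?S (k + e). of_nat (c (fst p)) * fcoeff g (fst p) * fcoeff f (snd p))"
      by (rule sum.reindex_bij_witness[where i = prod.swap and j = prod.swap]) (auto simp: add.commute)
    ultimately have "fcoeff (d (f * g)) k = fcoeff (d f * g) k + fcoeff (d g * f) k"
      by (simp add: sum.distrib *)
    then show "fcoeff (d (f * g)) k = fcoeff (d f * g + f * d g) k"
      by (simp add: mult.commute)
  qed
qed

lemma vec_axis_split: "n $ i \<noteq> 0 \<Longrightarrow> \<exists>m :: nat ^ 'n::finite. n = m + axis i 1"
  by (rule exI[of _ "\<chi> j. if j = i then n $ i - 1 else n $ j"]) (auto simp: vec_eq_iff axis_def)

lemma deriv_x_mult: "deriv_x i (f * g) = deriv_x i f * g + f * deriv_x i g"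
proof (rule weighted_shift_mult[where c = "\<lambda>k. fst k $ i" and e = "(axis i 1, 0)"])
  fix p :: "'a expo" assume "fst p $ i \<noteq> 0"
  then show "\<exists>p'. p = p' + (axis i 1, 0)"
    using vec_axis_split[of "fst p" i] by (metis add_Pair add_0_right prod.collapse)
qed (auto simp: fcoeff_deriv_x)

lemma deriv_y_mult: "deriv_y i (f * g) = deriv_y i f * g + f * deriv_y i g"
proof (rule weighted_shift_mult[where c = "\<lambda>k. snd k $ i" and e = "(0, axis i 1)"])
  fix p :: "'a expo" assume "snd p $ i \<noteq> 0"
  then show "\<exists>p'. p = p' + (0, axis i 1)"
    using vec_axis_split[of "snd p" i] by (metis add_Pair add_0_right prod.collapse)
qed (auto simp: fcoeff_deriv_y)

lemma deriv_add: "deriv_x i (f + g) = deriv_x i f + deriv_x i g"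
    "deriv_y i (f + g) = deriv_y i f + deriv_y i g"
  and deriv_diff: "deriv_x i (f - g) = deriv_x i f - deriv_x i g"
    "deriv_y i (f - g) = deriv_y i f - deriv_y i g"
  and deriv_fscale: "deriv_x i (fscale c f) = fscale c (deriv_x i f)"
    "deriv_y i (fscale c f) = fscale c (deriv_y i f)"
  by (auto intro!: fseries_eqI simp: fcoeff_deriv_x fcoeff_deriv_y algebra_simps)

lemma deriv_sum: "deriv_x i (sum F A) = (\<Sum>a\<in>A. deriv_x i (F a))"
    "deriv_y i (sum F A) = (\<Sum>a\<in>A. deriv_y i (F a))"
  by (auto intro!: fseries_eqI simp: fcoeff_deriv_x fcoeff_deriv_y sum_distrib_left)

lemma deriv_commute:
  "deriv_x i (deriv_x j f) = deriv_x j (deriv_x i f)"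
  "deriv_y i (deriv_y j f) = deriv_y j (deriv_y i f)"
  "deriv_x i (deriv_y j f) = deriv_y j (deriv_x i f)"
  by (rule fseries_eqI; cases "i = j"; simp add: fcoeff_deriv_x fcoeff_deriv_y axis_def ac_simps)+

text \<open>Partial derivatives commute with one another, hence they are derivations of the
  bracket.\<close>

lemma deriv_ham_field:
  "deriv_x i (ham_field G f) = ham_field (deriv_x i G) f + ham_field G (deriv_x i f)"
  "deriv_y i (ham_field G f) = ham_field (deriv_y i G) f + ham_field G (deriv_y i f)"
  unfolding ham_field_def deriv_sum deriv_diff deriv_x_mult deriv_y_mult sum.distrib[symmetric]
  by (rule sum.cong; simp add: deriv_commute algebra_simps)+

lemma ham_field_mult: "ham_field G (f * g) = ham_field G f * g + f * ham_field G g"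
  unfolding ham_field_def deriv_x_mult deriv_y_mult sum_distrib_left sum_distrib_right
    sum.distrib[symmetric]
  by (rule sum.cong) (simp_all add: algebra_simps)

lemma ham_field_add: "ham_field G (f + g) = ham_field G f + ham_field G g"
  and ham_field_diff: "ham_field G (f - g) = ham_field G f - ham_field G g"
  and ham_field_fscale: "ham_field G (fscale c f) = fscale c (ham_field G f)"
  unfolding ham_field_def deriv_add deriv_diff deriv_fscale fscale_sum sum.distrib[symmetric]
    sum_subtractf[symmetric]
  by (rule sum.cong; simp add: algebra_simps fscale_diff)+

lemma ham_field_antisym: "ham_field f g = - ham_field g f"
  unfolding ham_field_def sum_negf[symmetric] by (rule sum.cong) (simp_all add: mult.commute)

lemma ham_field_sum: "ham_field G (sum F A) = (\<Sum>a\<in>A. ham_field G (F a))"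
proof (induction A rule: infinite_finite_induct)
  have "ham_field G 0 = 0"
    using ham_field_add[of G 0 0] by simp
  then show "ham_field G (sum F A) = (\<Sum>a\<in>A. ham_field G (F a))" if "infinite A" for A
    using that by simp
  show "ham_field G (sum F {}) = (\<Sum>a\<in>{}. ham_field G (F a))"
    using \<open>ham_field G 0 = 0\<close> by simp
qed (simp add: ham_field_add)

text \<open>After the Leibniz rules, all terms with second derivatives of \<open>f\<close> or
  \<open>g\<close> cancel, leaving \<open>?R\<close> with second derivatives of \<open>G\<close>
  only. These cancel by symmetry of second derivatives.\<close>

lemma ham_field_jacobi:
  "ham_field G (ham_field f g) = ham_field (ham_field G f) g + ham_field f (ham_field G g)"
proof -
  let ?R = "\<lambda>i. ham_field (deriv_x i G) f * deriv_y i g + deriv_x i f * ham_field (deriv_y i G) g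
      - ham_field (deriv_y i G) f * deriv_x i g - deriv_y i f * ham_field (deriv_x i G) g"
  let ?x = deriv_x and ?y = deriv_y
  have "ham_field (ham_field G f) g + ham_field f (ham_field G g) - ham_field G (ham_field f g) = (\<Sum>i\<in>UNIV. ?R i)"
    unfolding ham_field_def[of "ham_field G f"] ham_field_def[of f] ham_field_sum
      ham_field_mult ham_field_diff deriv_ham_field sum.distrib[symmetric] sum_subtractf[symmetric]
    by (rule sum.cong) (simp_all add: algebra_simps)
  \<comment> \<open>Grouped by the kinds of derivatives falling on \<open>f\<close> and
    \<open>g\<close>, each double sum has a summand of the form A i j - A j i.\<close>
  also have "\<dots> = (\<Sum>i\<in>UNIV. \<Sum>j\<in>UNIV. ?x i (?x j G) * ?y j f * ?y i g - ?y i f * ?x i (?x j G) * ?y j g)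
     + (\<Sum>i\<in>UNIV. \<Sum>j\<in>UNIV. ?x i f * ?y i (?x j G) * ?y j g - ?x i (?y j G) * ?x j f * ?y i g)
     + (\<Sum>i\<in>UNIV. \<Sum>j\<in>UNIV. ?y i (?y j G) * ?x j f * ?x i g - ?x i f * ?y i (?y j G) * ?x j g)
     + (\<Sum>i\<in>UNIV. \<Sum>j\<in>UNIV. ?y i f * ?x i (?y j G) * ?x j g - ?y i (?x j G) * ?y j f * ?x i g)"
    unfolding ham_field_def sum_distrib_left sum_distrib_right sum.distrib[symmetric]
        sum_subtractf[symmetric]
    by (intro sum.cong refl) (simp add: deriv_commute algebra_simps)
  also have "\<dots> = 0"
  proof -
    have *: "(\<Sum>i\<in>UNIV. \<Sum>j\<in>UNIV. A i j - B i j) = 0"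
      if "\<And>i j. A i j = B j i" for A B :: "'a \<Rightarrow> 'a \<Rightarrow> 'a fseries"
      using that sum.swap[of B UNIV UNIV] by (simp add: sum_subtractf)
    show ?thesis
      by (subst (1 2 3 4) *) (simp_all add: deriv_commute ac_simps)
  qed
  finally show ?thesis
    by simp
qed

section \<open>Degree and weight\<close>

text \<open>The exponent of \<open>x_i y_i\<close>. A bracket multiplies two monomials and removes
  one such pair, so it lowers total degree by 2 and leaves weights additive.\<close>

definition bump :: "'n::finite \<Rightarrow> 'n expo" where
  "bump i = (axis i 1, axis i 1)"

text \<open>The exponents of \<open>f\<close> that can influence coefficient \<open>k\<close> of
  \<open>ham_field G f\<close>, uniformly in \<open>G\<close>.\<close>

definition nbhd :: "'n::finite expo \<Rightarrow> 'n expo set" where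
  "nbhd k = {q. \<exists>i p. p + q = k + bump i}"

lemma finite_nbhd: "finite (nbhd k)"
proof -
  have "nbhd k \<subseteq> (\<Union>i. snd ` {p. fst p + snd p = k + bump i})"
  proof
    fix q assume "q \<in> nbhd k"
    then obtain i p where "p + q = k + bump i"
      by (auto simp: nbhd_def)
    then have "(p, q) \<in> {p. fst p + snd p = k + bump i}"
      by simp
    then show "q \<in> (\<Union>i. snd ` {p. fst p + snd p = k + bump i})"
  by (intro UN_I[of i] image_eqI[of _ _ "(p, q)"]) auto
  qed
  then show ?thesis
    by (rule finite_subset) (intro finite_UN_I finite finite_imageI finite_expo_splits)
qed

lemma expo_deg_add: "expo_deg (p + q) = expo_deg p + expo_deg q"
  by (simp add: expo_deg_def sum.distrib)

lemma expo_deg_bump [simp]: "expo_deg (bump i) = 2"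
  by (simp add: expo_deg_def bump_def axis_def)

lemma weight_add: "weight lam (p + q) = weight lam p + weight lam q"
  by (simp add: weight_def sum.distrib[symmetric] algebra_simps)

lemma weight_bump [simp]: "weight lam (bump i) = 0"
  by (simp add: weight_def bump_def)

lemma times_coeff_nonzero:
  assumes "fcoeff (f * g) k \<noteq> 0"
  shows "\<exists>p q. p + q = k \<and> fcoeff f p \<noteq> 0 \<and> fcoeff g q \<noteq> 0"
proof -
  have "\<exists>p\<in>{p. fst p + snd p = k}. fcoeff f (fst p) * fcoeff g (snd p) \<noteq> 0"
    using assms sum.neutral unfolding fcoeff_times by meson
  then show ?thesis
    by auto
qed

text \<open>All later degree and weight estimates rest on this relation between exponents: apply an
  additive function to both sides of \<open>p + q = k + bump i\<close>.\<close>

lemma ham_field_coeff_nonzero: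
  assumes "fcoeff (ham_field G f) k \<noteq> 0"
  shows "\<exists>i p q. p + q = k + bump i \<and> fcoeff G p \<noteq> 0 \<and> fcoeff f q \<noteq> 0"
proof -
  have "\<exists>i\<in>UNIV. fcoeff (deriv_x i G * deriv_y i f - deriv_y i G * deriv_x i f) k \<noteq> 0"
    using assms sum.neutral unfolding ham_field_def fcoeff_sum by meson
  then obtain i where "fcoeff (deriv_x i G * deriv_y i f - deriv_y i G * deriv_x i f) k \<noteq> 0"
    by blast
  then have "fcoeff (deriv_x i G * deriv_y i f) k \<noteq> 0 \<or> fcoeff (deriv_y i G * deriv_x i f) k \<noteq> 0"
    by auto
  then show ?thesis
  proof
    assume "fcoeff (deriv_x i G * deriv_y i f) k \<noteq> 0"
    then obtain p q where pq: "p + q = k" "fcoeff (deriv_x i G) p \<noteq> 0" "fcoeff (deriv_y i f) q \<noteq> 0"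
      using times_coeff_nonzero by blast
    have "(p + (axis i 1, 0)) + (q + (0, axis i 1)) = k + bump i"
      unfolding pq(1)[symmetric] bump_def by (simp add: prod_eq_iff ac_simps)
    moreover have "fcoeff G (p + (axis i 1, 0)) \<noteq> 0" "fcoeff f (q + (0, axis i 1)) \<noteq> 0"
      using pq(2,3) unfolding fcoeff_deriv_x fcoeff_deriv_y by auto
    ultimately show ?thesis
      by blast
  next
    assume "fcoeff (deriv_y i G * deriv_x i f) k \<noteq> 0"
    then obtain p q where pq: "p + q = k" "fcoeff (deriv_y i G) p \<noteq> 0" "fcoeff (deriv_x i f) q \<noteq> 0"
      using times_coeff_nonzero by blast
    have "(p + (0, axis i 1)) + (q + (axis i 1, 0)) = k + bump i"
      unfolding pq(1)[symmetric] bump_def by (simp add: prod_eq_iff ac_simps)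
    moreover have "fcoeff G (p + (0, axis i 1)) \<noteq> 0" "fcoeff f (q + (axis i 1, 0)) \<noteq> 0"
      using pq(2,3) unfolding fcoeff_deriv_x fcoeff_deriv_y by auto
    ultimately show ?thesis
      by blast
  qed
qed

lemma fcont_ham_field: "fcont (ham_field G)"
  unfolding fcont_def
proof (intro conjI allI)
  fix k
  show "\<exists>K. finite K \<and> (\<forall>f. (\<forall>l\<in>K. fcoeff f l = 0) \<longrightarrow> fcoeff (ham_field G f) k = 0)"
  proof (intro exI[of _ "nbhd k"] conjI allI impI finite_nbhd)
    fix f assume f: "\<forall>l\<in>nbhd k. fcoeff f l = 0"
    show "fcoeff (ham_field G f) k = 0"
    proof (rule ccontr)
      assume "fcoeff (ham_field G f) k \<noteq> 0"
      then obtain i p q where "p + q = k + bump i" "fcoeff f q \<noteq> 0"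
        using ham_field_coeff_nonzero by blast
      then show False
        using f by (auto simp: nbhd_def)
    qed
  qed
qed (rule ham_field_add ham_field_fscale)+

lemma fcont_uminus_op: "fcont T \<Longrightarrow> fcont (\<lambda>f. - T f)"
  unfolding fcont_def by (simp add: fseries_eqI)

lemma fcont_ham_field_left: "fcont (\<lambda>G. ham_field G f)"
  unfolding ham_field_antisym[of _ f] by (intro fcont_uminus_op fcont_ham_field)

section \<open>Euler operators, the linear field and recovery of a Hamiltonian from its
  field\<close>

lemma fcoeff_var_mult:
  assumes v: "\<And>q. fcoeff v q = (if q = e then 1 else 0)"
  shows "fcoeff (v * g) (k + e) = fcoeff g k"
    and "(\<And>k. l \<noteq> k + e) \<Longrightarrow> fcoeff (v * g) l = 0"
proof -
  have "fcoeff (v * g) (k + e) = (\<Sum>p | fst p + snd p = k + e. if p = (e, k) then fcoeff g k else 0)"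
    unfolding fcoeff_times
  proof (rule sum.cong[OF refl])
    fix p assume "p \<in> {p. fst p + snd p = k + e}"
    then have "snd p = k" if "fst p = e"
      using that by (simp add: add.commute)
    then show "fcoeff v (fst p) * fcoeff g (snd p) = (if p = (e, k) then fcoeff g k else 0)"
      by (cases "fst p = e") (simp_all add: v prod_eq_iff[of p])
  qed
  also have "\<dots> = fcoeff g k"
    using finite_expo_splits[of "k + e"] by (simp add: add.commute)
  finally show "fcoeff (v * g) (k + e) = fcoeff g k" .
  assume l: "\<And>k. l \<noteq> k + e"
  show "fcoeff (v * g) l = 0"
  proof (rule ccontr)
    assume "fcoeff (v * g) l \<noteq> 0"
    then obtain p q where "p + q = l" "fcoeff v p \<noteq> 0"
      using times_coeff_nonzero by blast
    then have "l = q + e"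
      by (auto simp: v add.commute split: if_splits)
    then show False
      using l by blast
  qed
qed

lemma fcoeff_euler_x: "fcoeff (var_x i * deriv_x i f) k = of_nat (fst k $ i) * fcoeff f k"
proof (cases "fst k $ i = 0")
  case True
  then have "k \<noteq> k' + (axis i 1, 0)" for k'
    by auto
  then have "fcoeff (var_x i * deriv_x i f) k = 0"
    by (intro fcoeff_var_mult(2)) (simp_all add: var_x_def)
  with True show ?thesis
    by simp
next
  case False
  then obtain n where n: "fst k = n + axis i 1"
    using vec_axis_split by blast
  then have k: "k = (n, snd k) + (axis i 1, 0)"
    by (simp add: prod_eq_iff)
  have "fcoeff (var_x i * deriv_x i f) ((n, snd k) + (axis i 1, 0)) = fcoeff (deriv_x i f) (n, snd k)"
    by (rule fcoeff_var_mult(1)) (simp add: var_x_def)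
  then have "fcoeff (var_x i * deriv_x i f) k = fcoeff (deriv_x i f) (n, snd k)"
    unfolding k[symmetric] .
  also have "\<dots> = of_nat (fst k $ i) * fcoeff f k"
    unfolding fcoeff_deriv_x k[symmetric] by (simp add: n)
  finally show ?thesis .
qed

lemma fcoeff_euler_y: "fcoeff (var_y i * deriv_y i f) k = of_nat (snd k $ i) * fcoeff f k"
proof (cases "snd k $ i = 0")
  case True
  then have "k \<noteq> k' + (0, axis i 1)" for k'
    by auto
  then have "fcoeff (var_y i * deriv_y i f) k = 0"
    by (intro fcoeff_var_mult(2)) (simp_all add: var_y_def)
  with True show ?thesis
    by simp
next
  case False
  then obtain n where n: "snd k = n + axis i 1"
    using vec_axis_split by blast
  then have k: "k = (fst k, n) + (0, axis i 1)"
    by (simp add: prod_eq_iff)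
  have "fcoeff (var_y i * deriv_y i f) ((fst k, n) + (0, axis i 1)) = fcoeff (deriv_y i f) (fst k, n)"
    by (rule fcoeff_var_mult(1)) (simp add: var_y_def)
  then have "fcoeff (var_y i * deriv_y i f) k = fcoeff (deriv_y i f) (fst k, n)"
    unfolding k[symmetric] .
  also have "\<dots> = of_nat (snd k $ i) * fcoeff f k"
    unfolding fcoeff_deriv_y k[symmetric] by (simp add: n)
  finally show ?thesis .
qed

text \<open>Monomials are eigenvectors of the Euler operators, so \<open>lin_field\<close> is
  diagonal and the weights are its eigenvalues.\<close>

lemma fcoeff_lin_field: "fcoeff (lin_field lam f) k = weight lam k * fcoeff f k"
  unfolding lin_field_def fcoeff_diff fcoeff_sum fcoeff_fscale fcoeff_euler_x fcoeff_euler_y weight_def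
    sum_subtractf[symmetric] sum_distrib_right
  by (rule sum.cong) (simp_all add: algebra_simps)

lemma deriv_var [simp]:
  "deriv_x i (var_x j) = (if i = j then 1 else 0)" "deriv_y i (var_y j) = (if i = j then 1 else 0)"
  "deriv_x i (var_y j) = 0" "deriv_y i (var_x j) = 0"
proof -
  have *: "n + axis i 1 = axis j 1 \<longleftrightarrow> i = j \<and> n = 0" for n :: "nat ^ 'a"
    by (auto simp: vec_eq_iff axis_def)
  have **: "n + axis i 1 \<noteq> 0" for n :: "nat ^ 'a"
    by (auto simp: vec_eq_iff axis_def)
  show "deriv_x i (var_x j) = (if i = j then 1 else 0)"
  proof (rule fseries_eqI)
    fix k show "fcoeff (deriv_x i (var_x j)) k = fcoeff (if i = j then 1 else 0) k"
      using *[of "fst k"] by (cases k) (auto simp: fcoeff_deriv_x var_x_def one_fseries_def zero_prod_def)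
  qed
  show "deriv_y i (var_y j) = (if i = j then 1 else 0)"
  proof (rule fseries_eqI)
    fix k show "fcoeff (deriv_y i (var_y j)) k = fcoeff (if i = j then 1 else 0) k"
      using *[of "snd k"] by (cases k) (auto simp: fcoeff_deriv_y var_y_def one_fseries_def zero_prod_def)
  qed
  show "deriv_x i (var_y j) = 0"
  proof (rule fseries_eqI)
    fix k show "fcoeff (deriv_x i (var_y j)) k = fcoeff 0 k"
      using **[of "fst k"] by (cases k) (auto simp: fcoeff_deriv_x var_y_def)
  qed
  show "deriv_y i (var_x j) = 0"
  proof (rule fseries_eqI)
    fix k show "fcoeff (deriv_y i (var_x j)) k = fcoeff 0 k"
      using **[of "snd k"] by (cases k) (auto simp: fcoeff_deriv_y var_x_def)
  qed
qed

lemma ham_field_var: "ham_field G (var_y i) = deriv_x i G" "ham_field G (var_x i) = - deriv_y i G"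
proof -
  have "ham_field G (var_y i) = (\<Sum>j\<in>UNIV. if j = i then deriv_x j G else 0)"
    unfolding ham_field_def by (rule sum.cong) auto
  then show "ham_field G (var_y i) = deriv_x i G"
    by simp
  have "ham_field G (var_x i) = (\<Sum>j\<in>UNIV. if j = i then - deriv_y j G else 0)"
    unfolding ham_field_def by (rule sum.cong) auto
  then show "ham_field G (var_x i) = - deriv_y i G"
    by simp
qed

text \<open>Gives \<open>lin_field\<close> the linearity and continuity already proved for
  Hamiltonian fields.\<close>

lemma ham_field_quad_part: "ham_field (quad_part lam) = lin_field lam"
proof
  fix f
  have "deriv_x i (quad_part lam) = (\<Sum>j\<in>UNIV. if j = i then fscale (lam $ j) (var_y j) else 0)" for i
    unfolding quad_part_def deriv_sum deriv_fscale deriv_x_mult by (rule sum.cong) auto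
  moreover have "deriv_y i (quad_part lam) = (\<Sum>j\<in>UNIV. if j = i then fscale (lam $ j) (var_x j) else 0)" for i
    unfolding quad_part_def deriv_sum deriv_fscale deriv_y_mult by (rule sum.cong) auto
  ultimately show "ham_field (quad_part lam) f = lin_field lam f"
    by (simp add: ham_field_def lin_field_def sum_subtractf)
qed

lemma quad_part_coeff_nonzero:
  assumes "fcoeff (quad_part lam) k \<noteq> 0"
  shows "expo_deg k = 2" and "weight lam' k = 0"
proof -
  have "\<exists>i\<in>UNIV. lam $ i * fcoeff (var_x i * var_y i) k \<noteq> 0"
    using assms sum.neutral unfolding quad_part_def fcoeff_sum fcoeff_fscale by meson
  then obtain i where "fcoeff (var_x i * var_y i) k \<noteq> 0"
    by auto
  then obtain p q where "p + q = k" "fcoeff (var_x i) p \<noteq> 0" "fcoeff (var_y i) q \<noteq> 0"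
    using times_coeff_nonzero by blast
  then have k: "k = bump i"
    by (auto simp: var_x_def var_y_def bump_def split: if_splits)
  show "expo_deg k = 2" "weight lam' k = 0"
    by (simp_all add: k)
qed

text \<open>Applied to the coordinates, the field returns all first partial derivatives of its
  Hamiltonian, which leave only the constant term undetermined.\<close>

lemma ham_field_inject:
  assumes "ham_field G = ham_field G'" "k \<noteq> 0"
  shows "fcoeff G k = fcoeff G' k"
proof -
  have x: "deriv_x i G = deriv_x i G'" and y: "deriv_y i G = deriv_y i G'" for i
    using ham_field_var[of G i] ham_field_var[of G' i] assms(1) by simp_all
  obtain n m where k: "k = (n, m)"
    by (cases k)
  from \<open>k \<noteq> 0\<close> have "(\<exists>i. n $ i \<noteq> 0) \<or> (\<exists>i. m $ i \<noteq> 0)"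
    by (auto simp: k zero_prod_def vec_eq_iff)
  then show ?thesis
  proof (elim disjE exE)
    fix i assume "n $ i \<noteq> 0"
    then obtain n' where "n = n' + axis i 1"
      using vec_axis_split by blast
    moreover have "fcoeff (deriv_x i G) (n', m) = fcoeff (deriv_x i G') (n', m)"
      by (simp add: x)
    \<comment> \<open>The factor produced by the derivative is a positive integer, so it
      cancels.\<close>
    then have "fcoeff G (n' + axis i 1, m) = fcoeff G' (n' + axis i 1, m)"
      unfolding fcoeff_deriv_x by (simp del: of_nat_Suc)
    ultimately show ?thesis
      by (simp add: k)
  next
    fix i assume "m $ i \<noteq> 0"
    then obtain m' where "m = m' + axis i 1"
      using vec_axis_split by blast
    moreover have "fcoeff (deriv_y i G) (n, m') = fcoeff (deriv_y i G') (n, m')"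
      by (simp add: y)
    then have "fcoeff G (n, m' + axis i 1) = fcoeff G' (n, m' + axis i 1)"
      unfolding fcoeff_deriv_y by (simp del: of_nat_Suc)
    ultimately show ?thesis
      by (simp add: k)
  qed
qed

section \<open>Words and moulds as operators\<close>

text \<open>The component has degree at least 3 and the bracket removes 2, so the degree rises by at
  least 1; the removed pair has weight 0, so the weight shifts by exactly \<open>w\<close>.\<close>

lemma letter_field_coeff_nonzero:
  assumes "fcoeff (letter_field lam H w f) k \<noteq> 0"
  shows "\<exists>q\<in>nbhd k. fcoeff f q \<noteq> 0 \<and> weight lam k = w + weight lam q \<and>
           expo_deg q < expo_deg k \<and> w \<in> alphabet lam"
proof -
  obtain i p q where pq: "p + q = k + bump i" "fcoeff (hom_comp lam H w) p \<noteq> 0" "fcoeff f q \<noteq> 0"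
    using assms ham_field_coeff_nonzero unfolding letter_field_def by blast
  have p: "p \<in> higher_exps" "weight lam p = w"
    using pq(2) by (simp_all add: hom_comp_def split: if_splits)
  have "expo_deg p + expo_deg q = expo_deg k + 2"
    using arg_cong[OF pq(1), of expo_deg] by (simp add: expo_deg_add)
  then have "expo_deg q < expo_deg k"
    using p(1) by (simp add: higher_exps_def)
  moreover have "weight lam k = w + weight lam q"
    using arg_cong[OF pq(1), of "weight lam"] p(2) by (simp add: weight_add)
  moreover have "q \<in> nbhd k" "w \<in> alphabet lam"
    using pq(1) p by (auto simp: nbhd_def alphabet_def)
  ultimately show ?thesis
    using pq(3) by blast
qed

lemma fcont_letter_field: "fcont (letter_field lam H w)"
  unfolding letter_field_def by (rule fcont_ham_field)

lemma fcont_comp: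
  assumes S: "fcont S" and T: "fcont T"
  shows "fcont (\<lambda>f. S (T f))"
  unfolding fcont_def
proof (intro conjI allI)
  fix k
  obtain K where K: "finite K" "\<And>f. (\<forall>l\<in>K. fcoeff f l = 0) \<longrightarrow> fcoeff (S f) k = 0"
    using S unfolding fcont_def by blast
  have "\<forall>l. \<exists>L. finite L \<and> (\<forall>f. (\<forall>l\<in>L. fcoeff f l = 0) \<longrightarrow> fcoeff (T f) l = 0)"
    using T unfolding fcont_def by blast
  then obtain L where L: "\<And>l. finite (L l)" "\<And>l f. (\<forall>l\<in>L l. fcoeff f l = 0) \<longrightarrow> fcoeff (T f) l = 0"
    unfolding choice_iff by blast
  show "\<exists>K. finite K \<and> (\<forall>f. (\<forall>l\<in>K. fcoeff f l = 0) \<longrightarrow> fcoeff (S (T f)) k = 0)"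
    using K L by (intro exI[of _ "\<Union>l\<in>K. L l"]) simp
qed (simp_all add: fcont_add[OF S] fcont_add[OF T] fcont_fscale[OF S] fcont_fscale[OF T])

lemma word_field_Nil [simp]: "word_field lam H [] f = f"
  and word_field_Cons [simp]:
    "word_field lam H (w # ws) f = letter_field lam H w (word_field lam H ws f)"
  by (simp_all add: word_field_def)

lemma word_field_append: "word_field lam H (u @ v) f = word_field lam H u (word_field lam H v f)"
  by (induction u) simp_all

lemma fcont_word_field: "fcont (word_field lam H ws)"
proof (induction ws)
  case Nil
  then show ?case
    by (auto simp: fcont_def)
next
  case (Cons w ws)
  have "word_field lam H (w # ws) = (\<lambda>f. letter_field lam H w (word_field lam H ws f))"
    by (rule ext) simp
  then show ?case
    using fcont_comp[OF fcont_letter_field Cons.IH] by simp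
qed

lemma word_field_coeff_nonzero:
  assumes "fcoeff (word_field lam H ws f) k \<noteq> 0"
  shows "\<exists>q. fcoeff f q \<noteq> 0 \<and> weight lam k = sum_list ws + weight lam q \<and>
           expo_deg q + length ws \<le> expo_deg k \<and> ws \<in> lists (alphabet lam)"
  using assms
proof (induction ws arbitrary: k)
  case (Cons w ws)
  then obtain l where l: "fcoeff (word_field lam H ws f) l \<noteq> 0" "weight lam k = w + weight lam l"
      "expo_deg l < expo_deg k" "w \<in> alphabet lam"
    using letter_field_coeff_nonzero unfolding word_field_Cons by blast
  obtain q where "fcoeff f q \<noteq> 0" "weight lam l = sum_list ws + weight lam q"
      "expo_deg q + length ws \<le> expo_deg l" "ws \<in> lists (alphabet lam)"
    using Cons.IH[OF l(1)] by blast
  with l show ?case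
    by (intro exI[of _ q]) (auto simp: add.assoc)
qed auto

lemma word_field_eq_0: "ws \<notin> lists (alphabet lam) \<Longrightarrow> word_field lam H ws f = 0"
  using word_field_coeff_nonzero[of lam H ws f] by (intro fseries_eqI) auto

text \<open>The first letter of a word reaching \<open>k\<close> is a difference of two weights,
  hence determined by an intermediate exponent \<open>q\<close> in the finite set
  \<open>nbhd k\<close>. The remaining letters form a word reaching \<open>q\<close>, whose degree
  is smaller. The bound is uniform in \<open>f\<close>.\<close>

lemma finite_words: "finite {ws. \<exists>f. fcoeff (word_field lam H ws f) k \<noteq> 0}"
proof (induction "expo_deg k" arbitrary: k rule: less_induct)
  case less
  let ?W = "\<lambda>k. {ws. \<exists>f. fcoeff (word_field lam H ws f) k \<noteq> 0}"
  let ?N = "{q \<in> nbhd k. expo_deg q < expo_deg k}"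
  have "?W k \<subseteq> insert [] (\<Union>q\<in>?N. (#) (weight lam k - weight lam q) ` ?W q)"
  proof
    fix ws assume "ws \<in> ?W k"
    then obtain f where f: "fcoeff (word_field lam H ws f) k \<noteq> 0"
      by blast
    show "ws \<in> insert [] (\<Union>q\<in>?N. (#) (weight lam k - weight lam q) ` ?W q)"
    proof (cases ws)
      case (Cons w u)
      obtain q where q: "q \<in> nbhd k" "fcoeff (word_field lam H u f) q \<noteq> 0"
          "weight lam k = w + weight lam q" "expo_deg q < expo_deg k"
        using f letter_field_coeff_nonzero unfolding Cons word_field_Cons by blast
      have "ws = (weight lam k - weight lam q) # u"
        using q(3) Cons by simp
      moreover have "u \<in> ?W q"
        using q(2) by blast
      ultimately show ?thesis
        using q by blast
    qed simp
  qed
  moreover have "finite (insert [] (\<Union>q\<in>?N. (#) (weight lam k - weight lam q) ` ?W q))"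
    using less finite_nbhd[of k] by simp
  ultimately show ?case
    by (rule finite_subset)
qed

section \<open>Operators attached to moulds\<close>

text \<open>The sum runs over all complex words, which spares alphabet side conditions: a word with
  a letter outside the alphabet acts as zero. By \<open>finite_words\<close> every mould gives a
  summable family.\<close>

definition mould_op ::
  "complex ^ 'n::finite \<Rightarrow> 'n fseries \<Rightarrow> mould \<Rightarrow> 'n fseries \<Rightarrow> 'n fseries" where
  "mould_op lam H M f = fsum (\<lambda>ws. fscale (M ws) (word_field lam H ws f)) UNIV"

lemma has_fsum_mould_op:
  "has_fsum (\<lambda>ws. fscale (M ws) (word_field lam H ws f)) UNIV (mould_op lam H M f)"
  unfolding mould_op_def
proof (rule has_fsum_fsum)
  fix k
  have "{ws. fcoeff (fscale (M ws) (word_field lam H ws f)) k \<noteq> 0}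
      \<subseteq> {ws. \<exists>f. fcoeff (word_field lam H ws f) k \<noteq> 0}"
    by auto
  then show "finite {ws \<in> UNIV. fcoeff (fscale (M ws) (word_field lam H ws f)) k \<noteq> 0}"
    using finite_words[of lam H k] finite_subset by simp
qed

lemma mould_op_eqI:
  "has_fsum (\<lambda>ws. fscale (M ws) (word_field lam H ws f)) UNIV S \<Longrightarrow> mould_op lam H M f = S"
  unfolding mould_op_def by (rule fsum_eqI)

lemma mould_op_add: "mould_op lam H M (f + g) = mould_op lam H M f + mould_op lam H M g"
proof (rule mould_op_eqI)
  show "has_fsum (\<lambda>ws. fscale (M ws) (word_field lam H ws (f + g))) UNIV
      (mould_op lam H M f + mould_op lam H M g)"
    using has_fsum_add[OF has_fsum_mould_op[of M lam H f] has_fsum_mould_op[of M lam H g]]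
    by (simp add: fcont_add[OF fcont_word_field] fscale_add)
qed

lemma mould_op_plus: "mould_op lam H (\<lambda>ws. M ws + N ws) f = mould_op lam H M f + mould_op lam H N f"
proof (rule mould_op_eqI)
  have "fscale (M ws + N ws) g = fscale (M ws) g + fscale (N ws) g" for ws and g :: "'a fseries"
    by (rule fseries_eqI) (simp add: algebra_simps)
  then show "has_fsum (\<lambda>ws. fscale (M ws + N ws) (word_field lam H ws f)) UNIV
      (mould_op lam H M f + mould_op lam H N f)"
    using has_fsum_add[OF has_fsum_mould_op[of M lam H f] has_fsum_mould_op[of N lam H f]]
    by simp
qed

lemma finite_splits: "finite {p. fst p @ snd p = ws}"
proof -
  have "{p. fst p @ snd p = ws} = (\<lambda>i. (take i ws, drop i ws)) ` {..length ws}"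
  proof (intro set_eqI iffI)
    fix p assume "p \<in> {p. fst p @ snd p = ws}"
    then show "p \<in> (\<lambda>i. (take i ws, drop i ws)) ` {..length ws}"
      by (intro image_eqI[of _ _ "length (fst p)"]) (auto simp: prod_eq_iff)
  qed auto
  then show ?thesis
    by simp
qed

lemma mould_mult_conv: "mould_mult M N ws = (\<Sum>i\<le>length ws. M (take i ws) * N (drop i ws))"
  unfolding mould_mult_def
  by (rule sum.reindex_bij_witness[where i = "\<lambda>i. (take i ws, drop i ws)" and j = "\<lambda>p. length (fst p)"])
     auto

text \<open>Both sides sum the same double family over pairs \<open>(u, v)\<close>: grouping by the
  concatenation gives the mould product, summing over \<open>v\<close> first gives the
  composition.\<close>

lemma mould_op_mult: "mould_op lam H (mould_mult M N) f = mould_op lam H M (mould_op lam H N f)"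
proof (rule mould_op_eqI[symmetric])
  let ?D = "word_field lam H"
  define F where "F = (\<lambda>(u, v). fscale (M u) (?D u (fscale (N v) (?D v f))))"
  have "has_fsum F (UNIV \<times> UNIV)
      (mould_op lam H (mould_mult M N) f)"
  proof (rule has_fsumI)
    fix k
    let ?W = "{ws. \<exists>f. fcoeff (?D ws f) k \<noteq> 0}"
    \<comment> \<open>Each splitting is tagged with the word it splits. The tag is recoverable by
      concatenation, so dropping it is injective and leaves the finite set \<open>P\<close> of pairs
      that can contribute at \<open>k\<close>.\<close>
    let ?J = "SIGMA ws:?W. {p. fst p @ snd p = ws}"
    define P where "P = snd ` ?J"
    have W: "finite ?W"
      by (rule finite_words)
    have fin: "finite P"
      unfolding P_def by (intro finite_imageI finite_SigmaI W finite_splits)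
    have inj: "inj_on snd ?J"
      by (auto simp: inj_on_def)
    have coeff: "fcoeff (F p) k = M (fst p) * N (snd p) * fcoeff (?D (fst p @ snd p) f) k" for p
      by (simp add: F_def case_prod_beta word_field_append fcont_fscale[OF fcont_word_field])
    have "fcoeff (mould_op lam H (mould_mult M N) f) k
        = (\<Sum>ws\<in>?W. fcoeff (fscale (mould_mult M N ws) (?D ws f)) k)"
      by (rule has_fsum_coeff[OF has_fsum_mould_op]) (use W in auto)
    also have "\<dots> = (\<Sum>ws\<in>?W. \<Sum>p | fst p @ snd p = ws. M (fst p) * N (snd p) * fcoeff (?D ws f) k)"
      by (simp add: mould_mult_def sum_distrib_right)
    also have "\<dots> = (\<Sum>x\<in>?J. M (fst (snd x)) * N (snd (snd x)) * fcoeff (?D (fst x) f) k)"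
      by (subst sum.Sigma) (simp_all only: W finite_splits ball_simps simp_thms case_prod_unfold)
    also have "\<dots> = (\<Sum>x\<in>?J. M (fst (snd x)) * N (snd (snd x)) * fcoeff (?D (fst (snd x) @ snd (snd x)) f) k)"
      by (rule sum.cong) auto
    also have "\<dots> = (\<Sum>p\<in>P. M (fst p) * N (snd p) * fcoeff (?D (fst p @ snd p) f) k)"
      unfolding P_def by (rule sum.reindex[OF inj, unfolded o_def, symmetric])
    also have "\<dots> = (\<Sum>p\<in>P. fcoeff (F p) k)"
      unfolding coeff ..
    finally have "fcoeff (mould_op lam H (mould_mult M N) f) k = \<dots>" .
    moreover have "fcoeff (F p) k = 0"
      if "p \<notin> P" for p
    proof -
      have "fcoeff (?D (fst p @ snd p) f) k = 0"
      proof (rule ccontr)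
        assume "fcoeff (?D (fst p @ snd p) f) k \<noteq> 0"
        then have "(fst p @ snd p, p) \<in> ?J"
          by auto
        from imageI[OF this, of snd] that show False
          unfolding P_def by simp
      qed
      then show ?thesis
        unfolding coeff by simp
    qed
    ultimately show "\<exists>J. finite J \<and> J \<subseteq> UNIV \<times> UNIV \<and>
        (\<forall>i\<in>UNIV \<times> UNIV - J. fcoeff (F i) k = 0) \<and>
        fcoeff (mould_op lam H (mould_mult M N) f) k =
          (\<Sum>p\<in>J. fcoeff (F p) k)"
      using fin by (intro exI[of _ P]) auto
  qed
  then show "has_fsum (\<lambda>u. fscale (M u) (?D u (mould_op lam H N f))) UNIV
      (mould_op lam H (mould_mult M N) f)"
  unfolding F_def
  proof (rule has_fsum_Sigma)
    fix u
    show "has_fsum (\<lambda>v. fscale (M u) (?D u (fscale (N v) (?D v f)))) UNIV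
        (fscale (M u) (?D u (mould_op lam H N f)))"
      by (intro has_fsum_fscale fcont_has_fsum[OF fcont_word_field] has_fsum_mould_op)
  qed
qed

lemma mould_op_one [simp]: "mould_op lam H mould_one f = f"
proof (rule mould_op_eqI)
  show "has_fsum (\<lambda>ws. fscale (mould_one ws) (word_field lam H ws f)) UNIV f"
  proof (rule has_fsumI)
    fix k
    show "\<exists>J. finite J \<and> J \<subseteq> UNIV \<and>
        (\<forall>ws\<in>UNIV - J. fcoeff (fscale (mould_one ws) (word_field lam H ws f)) k = 0) \<and>
        fcoeff f k = (\<Sum>ws\<in>J. fcoeff (fscale (mould_one ws) (word_field lam H ws f)) k)"
      by (rule exI[of _ "{[]}"]) (simp add: mould_one_def)
  qed
qed

text \<open>\<open>word_field\<close> shifts weights by the sum of the word, and weights are the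
  eigenvalues of \<open>lin_field\<close>; hence the commutator is multiplication by that
  sum.\<close>

lemma word_field_lin_field:
  "lin_field lam (word_field lam H ws f) =
     word_field lam H ws (lin_field lam f) + fscale (sum_list ws) (word_field lam H ws f)"
proof (rule fseries_eqI)
  fix k
  let ?D = "word_field lam H ws"
  \<comment> \<open>The only input weight from which the word reaches \<open>k\<close>. Subtracting
    \<open>fscale a f\<close> annihilates precisely that part of
    \<open>lin_field lam f\<close>.\<close>
  define a where "a = weight lam k - sum_list ws"
  have "fcoeff (?D (lin_field lam f - fscale a f)) k = 0"
  proof (rule ccontr)
    assume n: "fcoeff (?D (lin_field lam f - fscale a f)) k \<noteq> 0"
    obtain q where q: "fcoeff (lin_field lam f - fscale a f) q \<noteq> 0" "weight lam k = sum_list ws + weight lam q"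
      using word_field_coeff_nonzero[OF n] by blast
    from q(2) have "a = weight lam q"
      by (simp add: a_def)
    with q(1) show False
      by (simp add: fcoeff_lin_field)
  qed
  then have "fcoeff (?D (lin_field lam f)) k = a * fcoeff (?D f) k"
    by (simp add: fcont_diff[OF fcont_word_field] fcont_fscale[OF fcont_word_field])
  then show "fcoeff (lin_field lam (?D f)) k = fcoeff (?D (lin_field lam f) + fscale (sum_list ws) (?D f)) k"
    by (simp add: fcoeff_lin_field a_def algebra_simps)
qed

lemma mould_op_nabla:
  "lin_field lam (mould_op lam H M f) =
     mould_op lam H M (lin_field lam f) + mould_op lam H (mould_nabla M) f"
proof -
  have "lin_field lam (fscale (M ws) (word_field lam H ws f)) =
      fscale (M ws) (word_field lam H ws (lin_field lam f)) + fscale (mould_nabla M ws) (word_field lam H ws f)" for ws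
    unfolding ham_field_quad_part[symmetric] ham_field_fscale
    unfolding ham_field_quad_part word_field_lin_field
    by (rule fseries_eqI) (simp add: mould_nabla_def algebra_simps)
  then have "has_fsum (\<lambda>ws. lin_field lam (fscale (M ws) (word_field lam H ws f))) UNIV
      (mould_op lam H M (lin_field lam f) + mould_op lam H (mould_nabla M) f)"
    using has_fsum_add[OF has_fsum_mould_op[of M lam H "lin_field lam f"] has_fsum_mould_op[of "mould_nabla M" lam H f]]
    by simp
  moreover have "has_fsum (\<lambda>ws. lin_field lam (fscale (M ws) (word_field lam H ws f))) UNIV
      (lin_field lam (mould_op lam H M f))"
    unfolding ham_field_quad_part[symmetric] by (rule fcont_has_fsum[OF fcont_ham_field has_fsum_mould_op])
  ultimately show ?thesis
    by (rule has_fsum_unique[symmetric])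
qed

lemma mould_op_letters:
  assumes M: "\<And>ws. length ws \<noteq> 1 \<Longrightarrow> M ws = 0"
    and S: "has_fsum (\<lambda>w. fscale (M [w]) (letter_field lam H w f)) UNIV S"
  shows "mould_op lam H M f = S"
proof (rule mould_op_eqI)
  have "bij_betw hd {ws :: complex list. length ws = 1} UNIV"
    by (rule bij_betw_byWitness[where f' = "\<lambda>w. [w]"]) (auto simp: length_Suc_conv)
  from has_fsum_reindex[OF this S]
  have "has_fsum (\<lambda>ws. fscale (M ws) (word_field lam H ws f)) {ws. length ws = 1} S"
    by (subst has_fsum_cong[where G = "\<lambda>ws. fscale (M [hd ws]) (letter_field lam H (hd ws) f)"])
       (auto simp: length_Suc_conv)
  then show "has_fsum (\<lambda>ws. fscale (M ws) (word_field lam H ws f)) UNIV S"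
    by (subst has_fsum_mono_neutral[of "{ws. length ws = 1}"]) (auto simp: M)
qed

section \<open>Exponentials\<close>

lemma mould_mult_letter:
  assumes M: "\<And>u. length u \<noteq> 1 \<Longrightarrow> M u = 0"
  shows "mould_mult M N [] = 0" "mould_mult M N (w # ws) = M [w] * N ws"
proof -
  show "mould_mult M N [] = 0"
    by (simp add: mould_mult_conv M)
  have "mould_mult M N (w # ws) = (\<Sum>i\<in>{1}. M (take i (w # ws)) * N (drop i (w # ws)))"
    unfolding mould_mult_conv by (rule sum.mono_neutral_right) (auto simp: M)
  then show "mould_mult M N (w # ws) = M [w] * N ws"
    by simp
qed

text \<open>Treats \<open>mould_V\<close> (\<open>c = 1\<close>) and its negative
  (\<open>c = -1\<close>) together. Since \<open>inverse 0 = 0\<close>, the letter 0 fits the same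
  formula.\<close>

context
  fixes M :: mould and c :: complex
  assumes M: "\<And>u. M u = (if length u = 1 then c * inverse (hd u) else 0)"
begin

lemma mould_power_letter:
  "(mould_mult M ^^ j) mould_one ws = (if length ws = j then c ^ j * prod_list (map inverse ws) else 0)"
proof (induction j arbitrary: ws)
  case 0
  then show ?case
    by (simp add: mould_one_def)
next
  case (Suc j)
  have "\<And>u. length u \<noteq> 1 \<Longrightarrow> M u = 0"
    by (simp add: M)
  note mult = mould_mult_letter[of M, OF this]
  show ?case
    by (cases ws) (simp_all add: mult Suc.IH, simp add: M)
qed

text \<open>The k-th power lives on words of length k, so the exponential series has a single
  possibly nonzero term at each word.\<close>

lemma mould_exp_letter:
  "mould_exp M ws = c ^ length ws * prod_list (map inverse ws) / fact (length ws)"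
proof -
  have "mould_exp M ws = (\<Sum>k\<in>{length ws}. (1 / fact k) * (mould_mult M ^^ k) mould_one ws)"
    unfolding mould_exp_def by (rule suminf_finite) (auto simp: mould_power_letter)
  then show ?thesis
    by (simp add: mould_power_letter)
qed

lemma op_exp_mould_op:
  assumes T: "\<And>g. T g = mould_op lam H M g"
  shows "op_exp T f = mould_op lam H (mould_exp M) f"
  unfolding op_exp_def
\<comment> \<open>Words are grouped by length; those of length \<open>j\<close> make up the
  \<open>j\<close>-th term of the operator exponential.\<close>
proof (rule fsum_eqI, rule has_fsum_group[OF has_fsum_mould_op])
  fix j
  let ?N = "(mould_mult M ^^ j) mould_one"
  have "(T ^^ i) f = mould_op lam H ((mould_mult M ^^ i) mould_one) f" for i
    by (induction i) (simp_all add: T mould_op_mult)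
  then have "has_fsum (\<lambda>ws. fscale (1 / fact j) (fscale (?N ws) (word_field lam H ws f))) UNIV
      (fscale (1 / fact j) ((T ^^ j) f))"
    using has_fsum_fscale[OF has_fsum_mould_op[of ?N lam H f], of "1 / fact j"] by simp
  then have "has_fsum (\<lambda>ws. fscale (1 / fact j) (fscale (?N ws) (word_field lam H ws f))) {ws. length ws = j}
      (fscale (1 / fact j) ((T ^^ j) f))"
    by (subst (asm) has_fsum_mono_neutral[of "{ws. length ws = j}"]) (auto simp: mould_power_letter)
  then show "has_fsum (\<lambda>ws. fscale (mould_exp M ws) (word_field lam H ws f)) {ws. length ws = j}
      (fscale (1 / fact j) ((T ^^ j) f))"
    by (subst has_fsum_cong) (auto simp: mould_power_letter mould_exp_letter)
qed

end

lemma mould_V_letter: "mould_V u = (if length u = 1 then 1 * inverse (hd u) else 0)"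
  by (simp add: mould_V_def divide_inverse)

lemma mould_neg_V_letter: "- mould_V u = (if length u = 1 then (-1) * inverse (hd u) else 0)"
  by (simp add: mould_V_letter)

text \<open>A cut of a word after \<open>i\<close> letters leaves the product of inverses unchanged
  and contributes a signed binomial coefficient over \<open>fact ?r\<close>. The binomial theorem
  then gives \<open>(1 + (-1)) ^ ?r\<close>, which is 1 only for the empty word.\<close>

lemma mould_exp_V_inverse: "mould_mult (mould_exp mould_V) (mould_exp (\<lambda>u. - mould_V u)) = mould_one"
proof
  fix ws :: "complex list"
  let ?r = "length ws"
  have "mould_mult (mould_exp mould_V) (mould_exp (\<lambda>u. - mould_V u)) ws =
    (\<Sum>i\<le>?r. prod_list (map inverse ws) / fact ?r * (of_nat (?r choose i) * 1 ^ i * (-1) ^ (?r - i)))"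
    unfolding mould_mult_conv
  proof (rule sum.cong)
    fix i assume "i \<in> {..?r}"
    then have i: "i \<le> ?r"
      by simp
    have "prod_list (map inverse (take i ws)) * prod_list (map inverse (drop i ws)) = prod_list (map inverse ws)"
      by (metis append_take_drop_id map_append prod_list.append)
    then show "mould_exp mould_V (take i ws) * mould_exp (\<lambda>u. - mould_V u) (drop i ws) =
        prod_list (map inverse ws) / fact ?r * (of_nat (?r choose i) * 1 ^ i * (-1) ^ (?r - i))"
      using i unfolding mould_exp_letter[OF mould_V_letter] mould_exp_letter[OF mould_neg_V_letter] binomial_fact[OF i]
      by (simp add: min_absorb2 field_simps)
  qed simp
  also have "\<dots> = prod_list (map inverse ws) / fact ?r * (1 + (-1)) ^ ?r"
    unfolding binomial_ring sum_distrib_left ..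
  also have "\<dots> = mould_one ws"
    by (simp add: mould_one_def power_0_left)
  finally show "mould_mult (mould_exp mould_V) (mould_exp (\<lambda>u. - mould_V u)) ws = mould_one ws" .
qed

section \<open>The exponential of a Hamiltonian field as an automorphism of the bracket\<close>

lemma ham_field_funpow_coeff_nonzero:
  assumes G: "\<forall>p. fcoeff G p \<noteq> 0 \<longrightarrow> p \<in> higher_exps"
    and "fcoeff ((ham_field G ^^ j) f) k \<noteq> 0"
  shows "\<exists>q. fcoeff f q \<noteq> 0 \<and> expo_deg q + j \<le> expo_deg k"
  using assms(2)
proof (induction j arbitrary: k)
  case (Suc j)
  then obtain i p q where pq: "p + q = k + bump i" "fcoeff G p \<noteq> 0" "fcoeff ((ham_field G ^^ j) f) q \<noteq> 0"
    using ham_field_coeff_nonzero[of G "(ham_field G ^^ j) f" k] by auto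
  have "expo_deg p + expo_deg q = expo_deg k + 2"
    using arg_cong[OF pq(1), of expo_deg] by (simp add: expo_deg_add)
  moreover have "3 \<le> expo_deg p"
    using G pq(2) by (simp add: higher_exps_def)
  moreover obtain l where "fcoeff f l \<noteq> 0" "expo_deg l + j \<le> expo_deg q"
    using Suc.IH[OF pq(3)] by blast
  ultimately show ?case
    by (intro exI[of _ l]) simp
qed auto

lemma has_fsum_op_exp:
  assumes G: "\<forall>p. fcoeff G p \<noteq> 0 \<longrightarrow> p \<in> higher_exps"
  shows "has_fsum (\<lambda>j. fscale (1 / fact j) ((ham_field G ^^ j) f)) UNIV (op_exp (ham_field G) f)"
  unfolding op_exp_def
proof (rule has_fsum_fsum)
  fix k
  have "{j \<in> UNIV. fcoeff (fscale (1 / fact j) ((ham_field G ^^ j) f)) k \<noteq> 0} \<subseteq> {..expo_deg k}"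
    using ham_field_funpow_coeff_nonzero[OF G] by fastforce
  then show "finite {j \<in> UNIV. fcoeff (fscale (1 / fact j) ((ham_field G ^^ j) f)) k \<noteq> 0}"
    by (rule finite_subset) simp
qed

text \<open>With divided powers the iterated Leibniz rule has no binomial coefficients and is the
  convolution of a Cauchy product.\<close>

lemma ham_field_leibniz:
  fixes f g G :: "'n::finite fseries"
  defines "e \<equiv> \<lambda>j h. fscale (1 / fact j) ((ham_field G ^^ j) h)"
  shows "e n (ham_field f g) = (\<Sum>i\<le>n. ham_field (e i f) (e (n - i) g))"
proof (induction n)
  case 0
  then show ?case
    by (simp add: e_def)
next
  case (Suc n)
  have step: "ham_field G (e i h) = fscale (of_nat (Suc i)) (e (Suc i) h)" for i h
    by (simp add: e_def ham_field_fscale del: of_nat_Suc)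
  have left: "ham_field (fscale c u) v = fscale c (ham_field u v)" for c and u v :: "'n fseries"
    by (rule fcont_fscale[OF fcont_ham_field_left])
  have "fscale (of_nat (Suc n)) (e (Suc n) (ham_field f g)) =
      (\<Sum>i\<le>n. ham_field G (ham_field (e i f) (e (n - i) g)))"
    unfolding step[symmetric] Suc.IH by (rule ham_field_sum)
  also have "\<dots> = fscale (of_nat (Suc n)) (\<Sum>i\<le>Suc n. ham_field (e i f) (e (Suc n - i) g))"
  proof (rule fseries_eqI)
    fix k
    define b where "b i j = fcoeff (ham_field (e i f) (e j g)) k" for i j
    have "fcoeff (\<Sum>i\<le>n. ham_field G (ham_field (e i f) (e (n - i) g))) k =
        (\<Sum>i\<le>n. of_nat (Suc i) * b (Suc i) (n - i)) + (\<Sum>i\<le>n. of_nat (Suc (n - i)) * b i (Suc (n - i)))"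
      unfolding ham_field_jacobi step left ham_field_fscale fcoeff_sum fcoeff_add fcoeff_fscale
        b_def[symmetric] sum.distrib ..
    \<comment> \<open>Both sums are extended to \<open>i \<le> Suc n\<close> by a term with factor
      0. The factors \<open>i\<close> and \<open>Suc n - i\<close> then add up to
      \<open>Suc n\<close>.\<close>
    also have "(\<Sum>i\<le>n. of_nat (Suc i) * b (Suc i) (n - i)) = (\<Sum>i\<le>Suc n. of_nat i * b i (Suc n - i))"
      by (subst sum.atMost_Suc_shift) simp
    also have "(\<Sum>i\<le>n. of_nat (Suc (n - i)) * b i (Suc (n - i))) = (\<Sum>i\<le>Suc n. of_nat (Suc n - i) * b i (Suc n - i))"
      by (simp add: Suc_diff_le algebra_simps)
    also have "(\<Sum>i\<le>Suc n. of_nat i * b i (Suc n - i)) + (\<Sum>i\<le>Suc n. of_nat (Suc n - i) * b i (Suc n - i)) =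
        (\<Sum>i\<le>Suc n. of_nat (Suc n) * b i (Suc n - i))"
      unfolding sum.distrib[symmetric] distrib_right[symmetric] of_nat_add[symmetric]
      by (rule sum.cong) simp_all
    finally show "fcoeff (\<Sum>i\<le>n. ham_field G (ham_field (e i f) (e (n - i) g))) k =
        fcoeff (fscale (of_nat (Suc n)) (\<Sum>i\<le>Suc n. ham_field (e i f) (e (Suc n - i) g))) k"
      unfolding fcoeff_fscale fcoeff_sum b_def sum_distrib_left .
  qed
  finally have "fscale (1 / of_nat (Suc n)) (fscale (of_nat (Suc n)) (e (Suc n) (ham_field f g))) =
      fscale (1 / of_nat (Suc n)) (fscale (of_nat (Suc n)) (\<Sum>i\<le>Suc n. ham_field (e i f) (e (Suc n - i) g)))"
    by (rule arg_cong)
  then show ?case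
    by (simp only: fscale_fscale) (simp del: of_nat_Suc)
qed

lemma op_exp_ham_field:
  fixes f g G :: "'n::finite fseries"
  assumes G: "\<forall>p. fcoeff G p \<noteq> 0 \<longrightarrow> p \<in> higher_exps"
  shows "op_exp (ham_field G) (ham_field f g) = ham_field (op_exp (ham_field G) f) (op_exp (ham_field G) g)"
proof -
  define e where "e = (\<lambda>j (h :: 'n fseries). fscale (1 / fact j) ((ham_field G ^^ j) h))"
  let ?E = "op_exp (ham_field G)"
  have E: "has_fsum (\<lambda>j. e j h) UNIV (?E h)" for h
    unfolding e_def by (rule has_fsum_op_exp[OF G])
  have e_deg: "j \<le> expo_deg k" if "fcoeff (e j h) k \<noteq> 0" for j h k
    using ham_field_funpow_coeff_nonzero[OF G, where j = j and f = h and k = k] that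
    by (auto simp: e_def)
  have "has_fsum (\<lambda>(i, j). ham_field (e i f) (e j g)) (UNIV \<times> UNIV) (?E (ham_field f g))"
  proof (rule has_fsumI)
    fix k :: "'n expo"
    \<comment> \<open>A contributing pair of exponents has total degree
      \<open>expo_deg k + 2\<close> because of the removed pair, and the \<open>i\<close>-th and
      \<open>j\<close>-th terms start at degrees \<open>i\<close> and \<open>j\<close>. So only
      \<open>i + j \<le> N\<close> matters.\<close>
    define N where "N = expo_deg k + 2"
    have "fcoeff (e j (ham_field f g)) k = 0" if "j \<notin> {..N}" for j
      using e_deg[of j "ham_field f g" k] that by (auto simp: N_def)
    then have "fcoeff (?E (ham_field f g)) k = (\<Sum>n\<le>N. fcoeff (e n (ham_field f g)) k)"
      by (intro has_fsum_coeff[OF E]) auto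
    also have "\<dots> = (\<Sum>n\<le>N. \<Sum>i\<le>n. fcoeff (ham_field (e i f) (e (n - i) g)) k)"
      unfolding e_def ham_field_leibniz by simp
    also have "\<dots> = (\<Sum>(i, j)\<in>{(i, j). i + j \<le> N}. fcoeff (ham_field (e i f) (e j g)) k)"
      by (rule sum.triangle_reindex_eq[symmetric])
    finally have sum: "fcoeff (?E (ham_field f g)) k =
        (\<Sum>x\<in>{(i, j). i + j \<le> N}. fcoeff ((\<lambda>(i, j). ham_field (e i f) (e j g)) x) k)"
      by (simp add: case_prod_unfold)
    have "i + j \<le> N" if n: "fcoeff (ham_field (e i f) (e j g)) k \<noteq> 0" for i j
    proof -
      obtain a p q where pq: "p + q = k + bump a" "fcoeff (e i f) p \<noteq> 0" "fcoeff (e j g) q \<noteq> 0"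
        using ham_field_coeff_nonzero[OF n] by blast
      have "expo_deg p + expo_deg q = N"
        using arg_cong[OF pq(1), of expo_deg] by (simp add: expo_deg_add N_def)
      then show ?thesis
        using e_deg[OF pq(2)] e_deg[OF pq(3)] by simp
    qed
    moreover have "finite {(i, j). i + j \<le> N}"
      by (rule finite_subset[of _ "{..N} \<times> {..N}"]) auto
    ultimately show "\<exists>J. finite J \<and> J \<subseteq> UNIV \<times> UNIV \<and>
        (\<forall>x\<in>UNIV \<times> UNIV - J. fcoeff ((\<lambda>(i, j). ham_field (e i f) (e j g)) x) k = 0) \<and>
        fcoeff (?E (ham_field f g)) k = (\<Sum>x\<in>J. fcoeff ((\<lambda>(i, j). ham_field (e i f) (e j g)) x) k)"
      using sum by (intro exI[of _ "{(i, j). i + j \<le> N}"]) auto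
  qed
  then have "has_fsum (\<lambda>i. ham_field (e i f) (?E g)) UNIV (?E (ham_field f g))"
    by (rule has_fsum_Sigma) (rule fcont_has_fsum[OF fcont_ham_field E])
  moreover have "has_fsum (\<lambda>i. ham_field (e i f) (?E g)) UNIV (ham_field (?E f) (?E g))"
    by (rule fcont_has_fsum[OF fcont_ham_field_left E])
  ultimately show ?thesis
    by (rule has_fsum_unique)
qed

section \<open>The simplified field\<close>

text \<open>Weights are additive and exponents of degree at least 3 are closed under addition, so
  the alphabet is closed under sums.\<close>

lemma new_alphabet_eq: "new_alphabet lam = alphabet lam"
proof
  have closed: "a + b \<in> alphabet lam" if ab: "a \<in> alphabet lam" "b \<in> alphabet lam" for a b
  proof -
    obtain p q where "p \<in> higher_exps" "q \<in> higher_exps" "a = weight lam p" "b = weight lam q"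
      using ab by (auto simp: alphabet_def)
    then have "a + b = weight lam (p + q)" "p + q \<in> higher_exps"
      by (simp_all add: weight_add higher_exps_def expo_deg_add)
    then show ?thesis
      by (auto simp: alphabet_def)
  qed
  have "sum_list ws \<in> alphabet lam" if "ws \<in> lists (alphabet lam)" "ws \<noteq> []" for ws
    using that
  proof (induction ws)
    case (Cons w ws)
    then show ?case
      by (cases "ws = []") (auto intro: closed)
  qed simp
  then show "new_alphabet lam \<subseteq> alphabet lam"
    by (auto simp: new_alphabet_def)
  show "alphabet lam \<subseteq> new_alphabet lam"
  proof
    fix w assume "w \<in> alphabet lam"
    then show "w \<in> new_alphabet lam"
      by (auto simp: new_alphabet_def intro!: exI[of _ "[w]"])
  qed
qed

lemma letter_field_eq_0: "w \<notin> alphabet lam \<Longrightarrow> letter_field lam H w f = 0"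
  using word_field_eq_0[of "[w]" lam H f] by simp

text \<open>Each exponent belongs to one weight only. Taking \<open>c = 1\<close> recovers the
  higher terms of \<open>H\<close>, and \<open>c w = 1 / w\<close> gives the generator.\<close>

lemma has_fsum_hom_comp:
  assumes K: "\<And>k. fcoeff K k = (if k \<in> higher_exps then c (weight lam k) * fcoeff H k else 0)"
  shows "has_fsum (\<lambda>w. fscale (c w) (hom_comp lam H w)) UNIV K"
proof (rule has_fsumI)
  fix k
  show "\<exists>J. finite J \<and> J \<subseteq> UNIV \<and> (\<forall>w\<in>UNIV - J. fcoeff (fscale (c w) (hom_comp lam H w)) k = 0) \<and>
      fcoeff K k = (\<Sum>w\<in>J. fcoeff (fscale (c w) (hom_comp lam H w)) k)"
    by (rule exI[of _ "{weight lam k}"]) (simp add: hom_comp_def K)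
qed

lemma has_fsum_letter_field:
  assumes K: "\<And>k. fcoeff K k = (if k \<in> higher_exps then c (weight lam k) * fcoeff H k else 0)"
  shows "has_fsum (\<lambda>w. fscale (c w) (letter_field lam H w f)) UNIV (ham_field K f)"
  using fcont_has_fsum[OF fcont_ham_field_left has_fsum_hom_comp[OF K], of f]
  by (simp add: letter_field_def fcont_fscale[OF fcont_ham_field_left])

lemma has_fsum_letters:
  assumes "formal_hamiltonian lam H"
  shows "has_fsum (\<lambda>w. letter_field lam H w f) UNIV (ham_field H f - lin_field lam f)"
proof -
  have "fcoeff (H - quad_part lam) k = (if k \<in> higher_exps then 1 * fcoeff H k else 0)" for k
  proof (cases "k \<in> higher_exps")
    case True
    then have "fcoeff (quad_part lam) k = 0"
      using quad_part_coeff_nonzero(1)[of lam k] by (cases "fcoeff (quad_part lam) k = 0") (simp_all add: higher_exps_def)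
    with True show ?thesis
      by simp
  next
    case False
    then show ?thesis
      using assms by (simp add: formal_hamiltonian_def)
  qed
  from has_fsum_letter_field[where c = "\<lambda>_. 1", OF this]
  have "has_fsum (\<lambda>w. letter_field lam H w f) UNIV (ham_field (H - quad_part lam) f)"
    by simp
  then show ?thesis
    unfolding fcont_diff[OF fcont_ham_field_left] ham_field_quad_part .
qed

text \<open>The solution G of the homological equation: \<open>lin_field lam\<close> sends it to the
  part of \<open>H\<close> of degree at least 3 and nonzero weight. Division by zero removes the
  resonant terms.\<close>

definition generator_hamiltonian :: "complex ^ 'n::finite \<Rightarrow> 'n fseries \<Rightarrow> 'n fseries" where
  "generator_hamiltonian lam H =
     Abs_fseries (\<lambda>k. if k \<in> higher_exps then 1 / weight lam k * fcoeff H k else 0)"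

text \<open>The letter \<open>0\<close> contributes nothing, as \<open>1 / 0 = 0\<close>.\<close>

lemma has_fsum_generator:
  "has_fsum (\<lambda>w. fscale (1 / w) (letter_field lam H w f)) UNIV (ham_field (generator_hamiltonian lam H) f)"
  by (rule has_fsum_letter_field) (simp add: generator_hamiltonian_def)

lemma sam_generator_eq: "sam_generator lam H = ham_field (generator_hamiltonian lam H)"
proof
  fix f
  have "has_fsum (\<lambda>w. fscale (1 / w) (letter_field lam H w f)) (alphabet lam - {0})
      (ham_field (generator_hamiltonian lam H) f)"
    using has_fsum_generator by (subst has_fsum_mono_neutral[symmetric, of _ UNIV]) (auto simp: letter_field_eq_0)
  then show "sam_generator lam H f = ham_field (generator_hamiltonian lam H) f"
    unfolding sam_generator_def by (rule fsum_eqI)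
qed

lemma sam_generator_mould_op: "sam_generator lam H f = mould_op lam H mould_V f"
proof -
  have "mould_op lam H mould_V f = ham_field (generator_hamiltonian lam H) f"
  proof (rule mould_op_letters)
    have "mould_V [w] = 1 / w" for w
      by (simp add: mould_V_def)
    then show "has_fsum (\<lambda>w. fscale (mould_V [w]) (letter_field lam H w f)) UNIV
        (ham_field (generator_hamiltonian lam H) f)"
      using has_fsum_generator by simp
  qed (simp add: mould_V_def)
  then show ?thesis
    by (simp add: sam_generator_eq)
qed

lemma mould_op_uminus: "mould_op lam H (\<lambda>u. - M u) f = - mould_op lam H M f"
proof -
  have "mould_op lam H (\<lambda>u. - M u + M u) f = 0"
    by (rule mould_op_eqI) (auto intro!: has_fsumI exI[of _ "{}"])
  then show ?thesis
    unfolding mould_op_plus by (simp add: eq_neg_iff_add_eq_0)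
qed

context
  fixes lam :: "complex ^ 'n::finite" and H :: "'n fseries"
begin

lemma op_exp_sam_generator:
  "op_exp (sam_generator lam H) f = mould_op lam H (mould_exp mould_V) f"
  "op_exp (\<lambda>f. - sam_generator lam H f) f = mould_op lam H (mould_exp (\<lambda>u. - mould_V u)) f"
proof -
  show "op_exp (sam_generator lam H) f = mould_op lam H (mould_exp mould_V) f"
    by (rule op_exp_mould_op[OF mould_V_letter]) (rule sam_generator_mould_op)
  show "op_exp (\<lambda>f. - sam_generator lam H f) f = mould_op lam H (mould_exp (\<lambda>u. - mould_V u)) f"
    by (rule op_exp_mould_op[OF mould_neg_V_letter]) (simp add: sam_generator_mould_op mould_op_uminus)
qed

lemma op_exp_sam_generator_inverse:
  "op_exp (sam_generator lam H) (op_exp (\<lambda>f. - sam_generator lam H f) f) = f"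
  unfolding op_exp_sam_generator mould_op_mult[symmetric] mould_exp_V_inverse by simp

lemma sam_field_mould_op:
  assumes "formal_hamiltonian lam H"
  shows "sam_field lam H f = lin_field lam f + mould_op lam H mould_Sam f"
proof -
  let ?E = "mould_op lam H (mould_exp mould_V)" and ?X = "lin_field lam"
  \<comment> \<open>Both products in \<open>mould_Sam\<close> end in the mould of exp(-T);
    evaluating at \<open>g\<close> absorbs that factor.\<close>
  define g where "g = mould_op lam H (mould_exp (\<lambda>u. - mould_V u)) f"
  define A where "A = mould_mult (mould_mult (mould_exp mould_V) mould_I) (mould_exp (\<lambda>u. - mould_V u))"
  define B where "B = mould_mult (mould_nabla (mould_exp mould_V)) (mould_exp (\<lambda>u. - mould_V u))"
  have Eg: "?E g = f"
    using op_exp_sam_generator_inverse unfolding g_def op_exp_sam_generator .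
  have I: "mould_op lam H mould_I g = ham_field H g - ?X g"
    by (rule mould_op_letters) (use has_fsum_letters[OF assms] in \<open>simp_all add: mould_I_def\<close>)
  have "mould_op lam H (\<lambda>ws. mould_Sam ws + B ws) f = mould_op lam H A f"
    by (rule arg_cong[where f = "\<lambda>M. mould_op lam H M f"]) (simp add: mould_Sam_def A_def B_def fun_eq_iff)
  then have "mould_op lam H mould_Sam f + mould_op lam H B f = mould_op lam H A f"
    unfolding mould_op_plus .
  moreover have "mould_op lam H A f = ?E (ham_field H g - ?X g)"
    unfolding A_def mould_op_mult g_def[symmetric] I ..
  \<comment> \<open>Moving \<open>?X\<close> past exp T costs the \<open>mould_nabla\<close> term,
    which is the subtracted product in \<open>mould_Sam\<close>.\<close>
  moreover have "?X f = ?E (?X g) + mould_op lam H B f"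
    using mould_op_nabla[of lam H "mould_exp mould_V" g] unfolding B_def mould_op_mult g_def[symmetric] Eg .
  moreover have "?E (ham_field H g) = ?E (ham_field H g - ?X g) + ?E (?X g)"
    unfolding mould_op_add[symmetric] by simp
  moreover have "sam_field lam H f = ?E (ham_field H g)"
    by (simp add: sam_field_def op_exp_sam_generator g_def)
  ultimately show ?thesis
    by (simp add: algebra_simps)
qed

lemma generator_hamiltonian_support:
  "\<forall>p. fcoeff (generator_hamiltonian lam H) p \<noteq> 0 \<longrightarrow> p \<in> higher_exps"
  by (simp add: generator_hamiltonian_def split: if_splits)

text \<open>Since exp T preserves the bracket and inverts exp(-T), conjugating the field of
  \<open>H\<close> amounts to replacing \<open>H\<close> by its image under exp T.\<close>

lemma sam_hamiltonian_op_exp: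
  assumes H: "formal_hamiltonian lam H"
  shows "sam_hamiltonian lam H (op_exp (sam_generator lam H) H)"
  unfolding sam_hamiltonian_def
proof
  let ?T = "ham_field (generator_hamiltonian lam H)"
  show "sam_field lam H = ham_field (op_exp (sam_generator lam H) H)"
  proof
    fix f
    show "sam_field lam H f = ham_field (op_exp (sam_generator lam H) H) f"
      using op_exp_ham_field[OF generator_hamiltonian_support, of H "op_exp (\<lambda>f. - sam_generator lam H f) f"]
        op_exp_sam_generator_inverse[of f]
      by (simp add: sam_field_def sam_generator_eq)
  qed
  show "formal_hamiltonian lam (op_exp (sam_generator lam H) H)"
    unfolding formal_hamiltonian_def
  proof (intro allI impI)
    fix k :: "'n expo" assume k: "k \<notin> higher_exps"
    \<comment> \<open>A term of degree at most 2 after \<open>j \<ge> 1\<close> applications would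
      originate from a monomial of \<open>H\<close> of degree at most 1, and \<open>H\<close> has
      none.\<close>
    have zero: "fcoeff (fscale (1 / fact j) ((?T ^^ j) H)) k = 0" if "j \<noteq> 0" for j
    proof (rule ccontr)
      assume "\<not> ?thesis"
      then have n: "fcoeff ((?T ^^ j) H) k \<noteq> 0"
        by simp
      obtain q where q: "fcoeff H q \<noteq> 0" "expo_deg q + j \<le> expo_deg k"
        using ham_field_funpow_coeff_nonzero[OF generator_hamiltonian_support n] by blast
      then have "expo_deg q < 2"
        using k that by (simp add: higher_exps_def)
      then have "fcoeff (quad_part lam) q \<noteq> 0"
        using q(1) H by (simp add: formal_hamiltonian_def higher_exps_def)
      then show False
        using quad_part_coeff_nonzero(1) \<open>expo_deg q < 2\<close> by fastforce
    qed
    have "fcoeff (op_exp ?T H) k = (\<Sum>j\<in>{0}. fcoeff (fscale (1 / fact j) ((?T ^^ j) H)) k)"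
      by (rule has_fsum_coeff[OF has_fsum_op_exp[OF generator_hamiltonian_support]]) (use zero in auto)
    also have "\<dots> = fcoeff H k"
      by simp
    also have "\<dots> = fcoeff (quad_part lam) k"
      using H k by (simp add: formal_hamiltonian_def)
    finally show "fcoeff (op_exp (sam_generator lam H) H) k = fcoeff (quad_part lam) k"
      by (simp add: sam_generator_eq)
  qed
qed

lemma sam_hamiltonian_unique:
  assumes "sam_hamiltonian lam H G" "sam_hamiltonian lam H G'"
  shows "G = G'"
proof (rule fseries_eqI)
  fix k :: "'n expo"
  show "fcoeff G k = fcoeff G' k"
  proof (cases "k = 0")
    case True
    then have "k \<notin> higher_exps"
      by (simp add: higher_exps_def expo_deg_def)
    then show ?thesis
      using assms by (simp add: sam_hamiltonian_def formal_hamiltonian_def)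
  next
    case False
    moreover have "ham_field G = ham_field G'"
      using assms by (simp add: sam_hamiltonian_def)
    ultimately show ?thesis
      using ham_field_inject by blast
  qed
qed

end

section \<open>Comparison of the parts of equal weight\<close>

text \<open>Unlike \<open>hom_comp\<close> this keeps the low degrees, as it is applied to arbitrary
  test series.\<close>

definition weight_part :: "complex ^ 'n::finite \<Rightarrow> complex \<Rightarrow> 'n fseries \<Rightarrow> 'n fseries" where
  "weight_part lam a f = Abs_fseries (\<lambda>k. if weight lam k = a then fcoeff f k else 0)"

text \<open>From weight \<open>weight lam k - s\<close> a word reaches \<open>k\<close> only if it
  shifts by \<open>s\<close>; conversely a word of sum \<open>s\<close> reads nothing else at
  \<open>k\<close>.\<close>

lemma word_field_weight_part:
  "fcoeff (word_field lam H ws (weight_part lam (weight lam k - s) f)) k =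
     (if sum_list ws = s then fcoeff (word_field lam H ws f) k else 0)"
proof -
  define g where "g = weight_part lam (weight lam k - s) f"
  have zero: "fcoeff (word_field lam H ws h) k = 0"
    if h: "\<And>q. weight lam k = sum_list ws + weight lam q \<Longrightarrow> fcoeff h q = 0" for h
    using word_field_coeff_nonzero[of lam H ws h k] h by blast
  show ?thesis
  proof (cases "sum_list ws = s")
    case True
    have "fcoeff (word_field lam H ws (f - g)) k = 0"
      by (rule zero) (simp add: g_def weight_part_def True)
    with True show ?thesis
      by (simp add: g_def fcont_diff[OF fcont_word_field])
  next
    case False
    then have "fcoeff (word_field lam H ws g) k = 0"
      by (intro zero) (simp add: g_def weight_part_def)
    with False show ?thesis
      by (simp add: g_def)
  qed
qed

text \<open>
  Evaluated on a series of a single weight, words and letters of different weights land in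
  different weights, so the total identity splits.
\<close>

lemma has_fsum_weight_component:
  assumes G: "formal_hamiltonian lam G"
    and M: "\<And>f. ham_field G f = lin_field lam f + mould_op lam H M f"
  shows "has_fsum (\<lambda>ws. fscale (M ws) (word_field lam H ws f)) {ws. sum_list ws = w} (letter_field lam G w f)"
proof (rule has_fsumI)
  fix k
  define g where "g = weight_part lam (weight lam k - w) f"
  let ?D = "word_field lam H"
  define W where "W = {ws. \<exists>f. fcoeff (?D ws f) k \<noteq> 0}"
  have fin: "finite W"
    unfolding W_def by (rule finite_words)
  have g: "fcoeff (?D ws g) k = (if sum_list ws = w then fcoeff (?D ws f) k else 0)" for ws
    unfolding g_def by (rule word_field_weight_part)
  \<comment> \<open>A letter is a one-letter word, so the same projection isolates the letter
    \<open>w\<close> of \<open>G\<close>.\<close>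
  have g': "fcoeff (letter_field lam G v g) k = (if v = w then fcoeff (letter_field lam G w f) k else 0)" for v
    using word_field_weight_part[of lam G "[v]" k w f] by (simp add: g_def)
  have "fcoeff (letter_field lam G w f) k = (\<Sum>v\<in>{w}. fcoeff (letter_field lam G v g) k)"
    by (simp add: g')
  also have "\<dots> = fcoeff (ham_field G g - lin_field lam g) k"
    by (rule has_fsum_coeff[OF has_fsum_letters[OF G], symmetric]) (simp_all add: g')
  also have "\<dots> = fcoeff (mould_op lam H M g) k"
    by (simp add: M)
  also have "\<dots> = (\<Sum>ws\<in>W. fcoeff (fscale (M ws) (?D ws g)) k)"
    by (rule has_fsum_coeff[OF has_fsum_mould_op fin]) (auto simp: W_def)
  also have "\<dots> = (\<Sum>ws\<in>{ws \<in> W. sum_list ws = w}. fcoeff (fscale (M ws) (?D ws f)) k)"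
    using fin by (intro sum.mono_neutral_cong_right) (auto simp: g)
  finally show "\<exists>J. finite J \<and> J \<subseteq> {ws. sum_list ws = w} \<and>
      (\<forall>ws\<in>{ws. sum_list ws = w} - J. fcoeff (fscale (M ws) (?D ws f)) k = 0) \<and>
      fcoeff (letter_field lam G w f) k = (\<Sum>ws\<in>J. fcoeff (fscale (M ws) (?D ws f)) k)"
    using fin by (intro exI[of _ "{ws \<in> W. sum_list ws = w}"]) (auto simp: W_def)
qed

theorem theorem7p5:
  fixes lam :: "complex ^ 'n::finite" and H :: "'n fseries"
  assumes "formal_hamiltonian lam H"
  shows "new_alphabet lam = alphabet lam \<and>
    (\<exists>!H1. sam_hamiltonian lam H H1) \<and>
    (\<forall>H1. sam_hamiltonian lam H H1 \<longrightarrow>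
      (\<forall>f. has_fsum (\<lambda>w. letter_field lam H1 w f) (new_alphabet lam)
              (sam_field lam H f - lin_field lam f)) \<and>
      (\<forall>w \<in> alphabet lam.
        is_hamiltonian (letter_field lam H1 w) \<and>
        (\<forall>f. has_fsum (\<lambda>ws. fscale (mould_Sam ws) (word_field lam H ws f))
              {ws \<in> lists (alphabet lam). sum_list ws = w}
              (letter_field lam H1 w f))))"
proof (intro conjI allI impI ballI)
  show "new_alphabet lam = alphabet lam"
    by (rule new_alphabet_eq)
  show "\<exists>!H1. sam_hamiltonian lam H H1"
    using sam_hamiltonian_op_exp[OF assms] sam_hamiltonian_unique by blast
next
  fix H1 f assume H1: "sam_hamiltonian lam H H1"
  have "has_fsum (\<lambda>w. letter_field lam H1 w f) UNIV (sam_field lam H f - lin_field lam f)"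
    using has_fsum_letters[of lam H1 f] H1 by (simp add: sam_hamiltonian_def)
  then show "has_fsum (\<lambda>w. letter_field lam H1 w f) (new_alphabet lam) (sam_field lam H f - lin_field lam f)"
    unfolding new_alphabet_eq
    by (subst has_fsum_mono_neutral[symmetric, of _ UNIV]) (auto simp: letter_field_eq_0)
next
  fix H1 w assume "sam_hamiltonian lam H H1"
  show "is_hamiltonian (letter_field lam H1 w)"
    unfolding is_hamiltonian_def letter_field_def by blast
next
  fix H1 w f assume H1: "sam_hamiltonian lam H H1"
  have "has_fsum (\<lambda>ws. fscale (mould_Sam ws) (word_field lam H ws f)) {ws. sum_list ws = w} (letter_field lam H1 w f)"
  proof (rule has_fsum_weight_component)
    show "formal_hamiltonian lam H1"
      using H1 by (simp add: sam_hamiltonian_def)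
    show "ham_field H1 f = lin_field lam f + mould_op lam H mould_Sam f" for f
      using H1 sam_field_mould_op[OF assms] by (simp add: sam_hamiltonian_def)
  qed
  then show "has_fsum (\<lambda>ws. fscale (mould_Sam ws) (word_field lam H ws f))
      {ws \<in> lists (alphabet lam). sum_list ws = w} (letter_field lam H1 w f)"
    using word_field_eq_0[of _ lam H f]
    by (subst has_fsum_mono_neutral[symmetric, of _ "{ws. sum_list ws = w}"]) (blast, force)
qed

end
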